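(* Let $d\ge18$ be an integer, $\kappa\in(0,1)$, and $0<\theta<\theta_0$, where $\theta_0=\frac{p/18-1}{2p+4}$ and $p=\lfloor 17d/16\rfloor$. Let $u_1,\dots,u_N$ be a choice of $N$ linearly independent, $\ell^2$-normalized eigenvectors of $X_NX_N^*$. Let $u_\alpha$ be one of them, with $X_NX_N^*u_\alpha=Eu_\alpha$ and $E\in(\kappa,4-\kappa)$. Then $$\max_{1\le i\le N}|u_\alpha(i)|^2\le C N^{-\theta}$$ holds with high probability, where $C>0$ is a constant independent of $N$. That is, for every choice of index $\alpha=\alpha_N\in\{1,\dots,N\}$, the probability that the eigenvalue $E$ of $u_\alpha$ lies in $(\kappa,4-\kappa)$ while $\max_{i}|u_\alpha(i)|^2>CN^{-\theta}$ tends to $0$ as $N\to\infty$.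
   Context: Random matrix ensemble: let $\rho:\mathbb R/\mathbb Z\to[0,\infty)$ be a probability density on the $1$-torus with bounded derivative, $\|\rho'\|_\infty\le C_\rho$ ($\rho$ does not depend on $N$). For every $N\ge1$, let $\{\omega_{j,q}\}_{1\le j\le N,\,1\le q\le d}$ be independent random variables on $\mathbb R/\mathbb Z$, each with distribution $\rho(\omega)\,d\omega$. The $N\times N$ random matrix $X_N$ is defined by $[X_N]_{jk}=\frac1{\sqrt N}\exp\left(2\pi i\sum_{q=1}^d\omega_{j,q}k^q\right)$. $\ell^2$-normalized means $\sum_{i=1}^N|u_\alpha(i)|^2=1$. An estimate $A\le B$ holds with high probability if $\mathbb P(A>B)\to0$ as $N\to\infty$ for every fixed value of $d$. *)

theory Defs
  imports
    "HOL-Probability.Probability"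
    "Jordan_Normal_Form.Schur_Decomposition"
    "Jordan_Normal_Form.VS_Connect"
begin

text \<open>A function on the torus \<open>\<real>/\<int>\<close> is a 1-periodic function on the reals, so differentiability
  and the derivative bound are required everywhere, including across integers.\<close>

definition torus_density :: "(real \<Rightarrow> real) \<Rightarrow> real \<Rightarrow> bool" where
  "torus_density \<rho> C\<^sub>\<rho> \<longleftrightarrow>
     (\<forall>x. \<rho> (x + 1) = \<rho> x) \<and>
     (\<forall>x. 0 \<le> \<rho> x) \<and>
     (\<rho> has_integral 1) {0..1} \<and>
     (\<forall>x. \<rho> differentiable (at x) \<and> \<bar>deriv \<rho> x\<bar> \<le> C\<^sub>\<rho>)"

text \<open>Points of \<open>\<real>/\<int>\<close> are given by their representatives in \<open>[0,1)\<close>, so the law \<open>\<rho>(\<omega>) d\<omega>\<close> becomes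
  the restriction of \<open>\<rho>\<close> to that interval. The argument \<open>\<omega> j q\<close> is used for
  \<open>1 \<le> j \<le> N\<close> and \<open>1 \<le> q \<le> d\<close> only.\<close>

definition iid_phases ::
  "'a measure \<Rightarrow> (real \<Rightarrow> real) \<Rightarrow> nat \<Rightarrow> nat \<Rightarrow> (nat \<Rightarrow> nat \<Rightarrow> 'a \<Rightarrow> real) \<Rightarrow> bool" where
  "iid_phases M \<rho> d N \<omega> \<longleftrightarrow>
     prob_space M \<and>
     prob_space.indep_vars M (\<lambda>_. borel) (\<lambda>(j, q). \<omega> j q) ({1..N} \<times> {1..d}) \<and>
     (\<forall>j\<in>{1..N}. \<forall>q\<in>{1..d}.
        distributed M lborel (\<omega> j q) (\<lambda>x. ennreal (\<rho> x * indicator {0..<1} x)))"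

text \<open>Library matrices are indexed from 0, hence the shift to row \<open>j + 1\<close> and column \<open>k + 1\<close>.\<close>

definition phase_matrix :: "nat \<Rightarrow> nat \<Rightarrow> (nat \<Rightarrow> nat \<Rightarrow> real) \<Rightarrow> complex mat" where
  "phase_matrix d N w = mat N N (\<lambda>(j, k).
     complex_of_real (1 / sqrt (real N)) *
     exp (2 * complex_of_real pi * \<i> *
       complex_of_real (\<Sum>q = 1..d. w (j + 1) q * real (k + 1) ^ q)))"

definition covariance_matrix :: "nat \<Rightarrow> nat \<Rightarrow> (nat \<Rightarrow> nat \<Rightarrow> real) \<Rightarrow> complex mat" where
  "covariance_matrix d N w = phase_matrix d N w * mat_adjoint (phase_matrix d N w)"

text \<open>Linear independence in the library is a property of sets; together with injectivity it is
  linear independence of the family \<open>u 1, \<dots>, u N\<close>.\<close>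

definition normalized_eigenbasis :: "nat \<Rightarrow> complex mat \<Rightarrow> (nat \<Rightarrow> complex vec) \<Rightarrow> bool" where
  "normalized_eigenbasis N A u \<longleftrightarrow>
     (\<forall>\<alpha>\<in>{1..N}. (\<exists>E. eigenvector A (u \<alpha>) E) \<and>
        (\<Sum>i<N. (cmod (vec_index (u \<alpha>) i))\<^sup>2) = 1) \<and>
     inj_on u {1..N} \<and>
     \<not> module.lin_dep class_ring (module_vec TYPE(complex) N) (u ` {1..N})"

definition moment_order :: "nat \<Rightarrow> nat" where
  "moment_order d = nat \<lfloor>17 * real d / 16\<rfloor>"

definition theta0 :: "nat \<Rightarrow> real" where
  "theta0 d = (real (moment_order d) / 18 - 1) / (2 * real (moment_order d) + 4)"

end

theory Submission
  imports Defs
begin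

unbundle no vec_syntax

text \<open>Let \<open>x\<^sub>i\<close> be the rows of \<open>X\<close>, \<open>y\<^sub>i = x\<^sub>i\<^sup>*\<close>, \<open>G(z) = (X\<^sup>*X - z)\<^sup>-\<^sup>1\<close>, \<open>G\<^sub>i\<close> the same resolvent without row \<open>i\<close>,
  and \<open>s\<^sub>i = y\<^sub>i\<^sup>* G\<^sub>i y\<^sub>i\<close>. With \<open>\<eta> = Im z = N powr (-\<theta>)\<close> and \<open>\<bar>E - Re z\<bar> \<le> \<eta>\<close>, an eigenvector satisfies
  \<open>E \<bar>u(i)\<bar>\<^sup>2 \<le> 2 \<eta> Im (y\<^sub>i\<^sup>* G y\<^sub>i) \<le> 2 \<eta> / \<bar>1 + s\<^sub>i\<bar>\<close>, so it suffices to bound \<open>\<bar>1 + s\<^sub>i\<bar>\<close> below.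

  Conditionally on the other rows, \<open>s\<^sub>i - tr G\<^sub>i / N\<close> is a trigonometric polynomial in the phases of
  row \<open>i\<close>. Since \<open>\<rho>\<close> is bounded, its fourth moment is at most a constant times the one for uniform
  phases, where power sums of degree at most 8 leave only the diagonal solutions; this gives
  \<open>O(N\<^sup>-\<^sup>2 \<eta>\<^sup>-\<^sup>4)\<close>. A union bound over the rows and over a grid of \<open>O(1/\<eta>)\<close> energies shows that, with
  failure probability \<open>O(N\<^sup>-\<^sup>1 \<eta>\<^sup>-\<^sup>9)\<close>, every \<open>s\<^sub>i\<close> is within \<open>c \<eta>\<close> of \<open>m = tr G / N\<close>; here
  \<open>9 \<theta> < 1\<close> because \<open>theta0 d < 1/36\<close>.

  Finally \<open>- z m\<close> is the average of the \<open>1 / (1 + s\<^sub>i)\<close>. As \<open>Im m \<ge> \<eta> / 256\<close> always holds, the error is small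
  relative to \<open>\<bar>1 + m\<bar>\<close>, so \<open>- z m\<close> is comparable to \<open>1 / (1 + m)\<close>, which keeps \<open>1 + m\<close>, and hence
  every \<open>1 + s\<^sub>i\<close>, away from 0.\<close>

section \<open>Resolvents of Gram matrices\<close>

text \<open>Vectors are functions on the naturals of which only the values below \<open>N\<close>
  count, so equality of solutions is claimed for \<open>k < N\<close> only.\<close>

definition cip :: "nat \<Rightarrow> (nat \<Rightarrow> complex) \<Rightarrow> (nat \<Rightarrow> complex) \<Rightarrow> complex" where
  "cip N f g = (\<Sum>k<N. cnj (f k) * g k)"

definition nsq :: "nat \<Rightarrow> (nat \<Rightarrow> complex) \<Rightarrow> real" where
  "nsq N f = (\<Sum>k<N. (cmod (f k))\<^sup>2)"

definition app :: "nat \<Rightarrow> (nat \<Rightarrow> nat \<Rightarrow> complex) \<Rightarrow> (nat \<Rightarrow> complex) \<Rightarrow> nat \<Rightarrow> complex" where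
  "app N x g j = (\<Sum>l<N. x j l * g l)"

text \<open>\<open>(X\<^sub>J\<^sup>* X\<^sub>J - z) g = f\<close>, where \<open>X\<^sub>J\<close> has the rows \<open>x j\<close> for \<open>j \<in> J\<close>.\<close>

definition resolves ::
  "nat \<Rightarrow> nat set \<Rightarrow> (nat \<Rightarrow> nat \<Rightarrow> complex) \<Rightarrow> complex \<Rightarrow> (nat \<Rightarrow> complex) \<Rightarrow> (nat \<Rightarrow> complex) \<Rightarrow> bool" where
  "resolves N J x z f g \<longleftrightarrow>
     (\<forall>k<N. (\<Sum>j\<in>J. cnj (x j k) * app N x g j) - z * g k = f k)"

lemma nsq_nonneg [simp]: "0 \<le> nsq N f"
  by (simp add: nsq_def sum_nonneg)

lemma cip_self: "cip N f f = of_real (nsq N f)"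
  by (simp add: cip_def nsq_def complex_norm_square mult.commute del: of_real_power)

lemma cip_commute: "cip N f g = cnj (cip N g f)"
  by (simp add: cip_def mult.commute)

lemma cip_Cauchy_Schwarz: "(cmod (cip N f g))\<^sup>2 \<le> nsq N f * nsq N g"
proof -
  have "cmod (cip N f g) \<le> (\<Sum>k<N. cmod (f k) * cmod (g k))"
    unfolding cip_def by (rule order_trans[OF norm_sum]) (simp add: norm_mult)
  then have "(cmod (cip N f g))\<^sup>2 \<le> (\<Sum>k<N. cmod (f k) * cmod (g k))\<^sup>2"
    by (simp add: power_mono)
  also have "\<dots> \<le> nsq N f * nsq N g"
    unfolding nsq_def by (rule Cauchy_Schwarz_ineq_sum)
  finally show ?thesis .
qed

lemma cmod_le_nsq: "k < N \<Longrightarrow> (cmod (f k))\<^sup>2 \<le> nsq N f"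
  unfolding nsq_def by (rule member_le_sum) auto

lemma nsq_eq_0D: "nsq N f = 0 \<Longrightarrow> k < N \<Longrightarrow> f k = 0"
  using cmod_le_nsq[of k N f] by simp

section \<open>A priori bounds and uniqueness for the resolvent equation\<close>

lemma resolves_weak:
  assumes "resolves N J x z f g"
  shows "cip N h f = (\<Sum>j\<in>J. cnj (app N x h j) * app N x g j) - z * cip N h g"
proof -
  have "cip N h f = (\<Sum>k<N. cnj (h k) * ((\<Sum>j\<in>J. cnj (x j k) * app N x g j) - z * g k))"
    using assms by (auto simp: cip_def resolves_def intro!: sum.cong)
  also have "\<dots> = (\<Sum>k<N. \<Sum>j\<in>J. cnj (x j k * h k) * app N x g j) - z * cip N h g"
    by (simp add: right_diff_distrib sum_subtractf sum_distrib_left cip_def ac_simps)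
  also have "(\<Sum>k<N. \<Sum>j\<in>J. cnj (x j k * h k) * app N x g j) =
      (\<Sum>j\<in>J. \<Sum>k<N. cnj (x j k * h k) * app N x g j)"
    by (rule sum.swap)
  also have "\<dots> = (\<Sum>j\<in>J. cnj (app N x h j) * app N x g j)"
    by (simp add: app_def[of N x h] sum_distrib_right)
  finally show ?thesis .
qed

text \<open>Testing against \<open>g\<close> itself makes the Gram part real and nonnegative, so the
  imaginary part comes from \<open>z\<close> alone.\<close>

lemma resolves_energy:
  assumes "resolves N J x z f g"
  shows "cip N g f = of_real (\<Sum>j\<in>J. (cmod (app N x g j))\<^sup>2) - z * of_real (nsq N g)"
  using resolves_weak[OF assms, of g]
  by (simp add: cip_self complex_norm_square mult.commute del: of_real_power)

text \<open>The Ward identity. The sign is opposite to that in \<open>resolves_energy\<close>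
  because the arguments of \<open>cip\<close> are exchanged.\<close>

lemma Im_resolves:
  assumes "resolves N J x z f g"
  shows "Im (cip N f g) = Im z * nsq N g"
  by (subst cip_commute) (simp add: resolves_energy[OF assms])

text \<open>The operator norm of the resolvent is at most \<open>1 / Im z\<close>: bound the Ward
  identity by Cauchy-Schwarz and cancel one factor \<open>nsq N g\<close>.\<close>

lemma nsq_resolves_le:
  assumes "resolves N J x z f g" and "0 < Im z"
  shows "(Im z)\<^sup>2 * nsq N g \<le> nsq N f"
proof (cases "nsq N g = 0")
  case False
  then have pos: "0 < nsq N g"
    using nsq_nonneg[of N g] by linarith
  have "(Im z * nsq N g)\<^sup>2 \<le> (cmod (cip N f g))\<^sup>2"
    using abs_Im_le_cmod[of "cip N f g"] Im_resolves[OF assms(1)] assms(2) pos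
    by (intro power_mono) auto
  also have "\<dots> \<le> nsq N f * nsq N g"
    by (rule cip_Cauchy_Schwarz)
  finally have "((Im z)\<^sup>2 * nsq N g) * nsq N g \<le> nsq N f * nsq N g"
    by (simp add: power2_eq_square ac_simps)
  then show ?thesis
    using pos by simp
qed simp

lemma app_lincomb:
  "app N x (\<lambda>k. a * g k + b * h k) j = a * app N x g j + b * app N x h j"
  by (simp add: app_def algebra_simps sum.distrib sum_distrib_left)

lemma app_sum:
  "app N x (\<lambda>k. \<Sum>l\<in>L. c l * g l k) j = (\<Sum>l\<in>L. c l * app N x (g l) j)"
  unfolding app_def sum_distrib_left by (subst sum.swap) (simp add: ac_simps)

lemma resolves_lincomb:
  assumes "resolves N J x z f g" and "resolves N J x z f' g'"
  shows "resolves N J x z (\<lambda>k. a * f k + b * f' k) (\<lambda>k. a * g k + b * g' k)"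
  unfolding resolves_def app_lincomb
proof (intro allI impI)
  fix k assume "k < N"
  then have *: "f k = (\<Sum>j\<in>J. cnj (x j k) * app N x g j) - z * g k"
    "f' k = (\<Sum>j\<in>J. cnj (x j k) * app N x g' j) - z * g' k"
    using assms by (simp_all add: resolves_def)
  show "(\<Sum>j\<in>J. cnj (x j k) * (a * app N x g j + b * app N x g' j)) - z * (a * g k + b * g' k)
     = a * f k + b * f' k"
    unfolding * by (simp add: algebra_simps sum.distrib sum_distrib_left)
qed

lemma resolves_sum:
  assumes "\<And>l. l \<in> L \<Longrightarrow> resolves N J x z (f l) (g l)"
  shows "resolves N J x z (\<lambda>k. \<Sum>l\<in>L. c l * f l k) (\<lambda>k. \<Sum>l\<in>L. c l * g l k)"
  unfolding resolves_def app_sum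
proof (intro allI impI)
  fix k assume "k < N"
  then have "(\<Sum>l\<in>L. c l * f l k) =
      (\<Sum>l\<in>L. c l * ((\<Sum>j\<in>J. cnj (x j k) * app N x (g l) j) - z * g l k))"
    using assms by (auto simp: resolves_def intro!: sum.cong)
  also have "\<dots> = (\<Sum>l\<in>L. \<Sum>j\<in>J. cnj (x j k) * (c l * app N x (g l) j)) -
      z * (\<Sum>l\<in>L. c l * g l k)"
    by (simp add: right_diff_distrib sum_subtractf sum_distrib_left ac_simps)
  also have "(\<Sum>l\<in>L. \<Sum>j\<in>J. cnj (x j k) * (c l * app N x (g l) j)) =
      (\<Sum>j\<in>J. cnj (x j k) * (\<Sum>l\<in>L. c l * app N x (g l) j))"
    by (subst sum.swap) (simp add: sum_distrib_left)
  finally show "(\<Sum>j\<in>J. cnj (x j k) * (\<Sum>l\<in>L. c l * app N x (g l) j)) - z * (\<Sum>l\<in>L. c l * g l k) =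
      (\<Sum>l\<in>L. c l * f l k)"
    by simp
qed

text \<open>The difference of the two solutions solves the homogeneous equation, and the norm bound
  makes it vanish. The perturbation formulas below exhibit two solutions of one equation and appeal
  to this lemma.\<close>

lemma resolves_unique:
  assumes "resolves N J x z f g" and "resolves N J x z f' g'" and "0 < Im z"
    and "\<And>k. k < N \<Longrightarrow> f k = f' k" and "k < N"
  shows "g k = g' k"
proof -
  have "resolves N J x z (\<lambda>k. 1 * f k + (-1) * f' k) (\<lambda>k. 1 * g k + (-1) * g' k)"
    by (rule resolves_lincomb) fact+
  from nsq_resolves_le[OF this \<open>0 < Im z\<close>]
  have "(Im z)\<^sup>2 * nsq N (\<lambda>k. 1 * g k + (-1) * g' k) \<le> 0"
    using assms(4) by (simp add: nsq_def)
  then have "nsq N (\<lambda>k. 1 * g k + (-1) * g' k) = 0"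
    using \<open>0 < Im z\<close> nsq_nonneg[of N "\<lambda>k. 1 * g k + (-1) * g' k"]
    by (smt (verit) mult_pos_pos zero_less_power)
  from nsq_eq_0D[OF this \<open>k < N\<close>] show ?thesis
    by simp
qed

text \<open>The rank-one term of row \<open>i\<close> moves from the operator to the right-hand
  side. All row removal formulas start from this.\<close>

lemma resolves_insert_row:
  assumes "resolves N (J - {i}) x z f g" and "finite J" and "i \<in> J"
  shows "resolves N J x z (\<lambda>k. 1 * f k + app N x g i * cnj (x i k)) g"
  using assms(1) sum.remove[OF assms(2,3), of "\<lambda>j. cnj (x j k) * app N x g j" for k]
  by (simp add: resolves_def algebra_simps)

section \<open>The explicit resolvent and its dependence on a single row\<close>

definition green_mat :: "nat \<Rightarrow> nat set \<Rightarrow> (nat \<Rightarrow> nat \<Rightarrow> complex) \<Rightarrow> complex \<Rightarrow> complex mat" where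
  "green_mat N J x z =
     mat N N (\<lambda>(k, l). (\<Sum>j\<in>J. cnj (x j k) * x j l) - (if k = l then z else 0))"

text \<open>Cramer's rule instead of an abstract inverse, so that measurability in \<open>x\<close> is immediate.\<close>

definition green :: "nat \<Rightarrow> nat set \<Rightarrow> (nat \<Rightarrow> nat \<Rightarrow> complex) \<Rightarrow> complex \<Rightarrow> nat \<Rightarrow> nat \<Rightarrow> complex" where
  "green N J x z l k = adj_mat (green_mat N J x z) $$ (k, l) / det (green_mat N J x z)"

lemma green_mat_carrier [simp]: "green_mat N J x z \<in> carrier_mat N N"
  by (simp add: green_mat_def)

lemma green_mat_row_sum:
  assumes "k < N"
  shows "(\<Sum>l<N. green_mat N J x z $$ (k, l) * g l) =
    (\<Sum>j\<in>J. cnj (x j k) * app N x g j) - z * g k"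
proof -
  have "(\<Sum>l<N. green_mat N J x z $$ (k, l) * g l) =
      (\<Sum>l<N. (\<Sum>j\<in>J. cnj (x j k) * (x j l * g l)) - (if k = l then z * g l else 0))"
    using assms by (intro sum.cong)
      (auto simp: green_mat_def algebra_simps sum_distrib_left)
  also have "\<dots> = (\<Sum>l<N. \<Sum>j\<in>J. cnj (x j k) * (x j l * g l)) - z * g k"
    using assms by (simp add: sum_subtractf)
  also have "(\<Sum>l<N. \<Sum>j\<in>J. cnj (x j k) * (x j l * g l)) = (\<Sum>j\<in>J. cnj (x j k) * app N x g j)"
    by (subst sum.swap) (simp add: app_def sum_distrib_left)
  finally show ?thesis .
qed

text \<open>A kernel vector would solve the homogeneous equation, whose only solution is zero for
  \<open>z\<close> in the upper half plane.\<close>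

lemma det_green_mat_nonzero:
  assumes "0 < Im z"
  shows "det (green_mat N J x z) \<noteq> 0"
proof
  assume "det (green_mat N J x z) = 0"
  then obtain v where v: "v \<in> carrier_vec N" "v \<noteq> 0\<^sub>v N" "green_mat N J x z *\<^sub>v v = 0\<^sub>v N"
    using det_0_iff_vec_prod_zero[OF green_mat_carrier] by metis
  have "resolves N J x z (\<lambda>_. 0) (vec_index v)"
    unfolding resolves_def
  proof (intro allI impI)
    fix k assume k: "k < N"
    have "(\<Sum>l<N. green_mat N J x z $$ (k, l) * v $ l) = (green_mat N J x z *\<^sub>v v) $ k"
      using k v(1) by (auto simp: scalar_prod_def lessThan_atLeast0 carrier_matD[OF green_mat_carrier]
          intro!: sum.cong)
    then show "(\<Sum>j\<in>J. cnj (x j k) * app N x (vec_index v) j) - z * v $ k = 0"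
      using v(3) k by (simp add: green_mat_row_sum)
  qed
  moreover have "resolves N J x z (\<lambda>_. 0) (\<lambda>_. 0)"
    by (simp add: resolves_def app_def)
  ultimately have "v $ k = 0" if "k < N" for k
    using resolves_unique[of N J x z "\<lambda>_. 0" "vec_index v" "\<lambda>_. 0" "\<lambda>_. 0"] assms that by blast
  then have "v = 0\<^sub>v N"
    using v(1) by (intro eq_vecI) auto
  with v(2) show False by simp
qed

text \<open>The product of a matrix with its adjugate is the determinant times the identity. Since
  \<open>green\<close> takes the column index first, \<open>green N J x z l\<close> is column
  \<open>l\<close> of the inverse.\<close>

lemma green_resolves:
  assumes "0 < Im z" and "l < N"
  shows "resolves N J x z (\<lambda>k. if k = l then 1 else 0) (green N J x z l)"
  unfolding resolves_def
proof (intro allI impI)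
  fix k assume k: "k < N"
  let ?A = "green_mat N J x z"
  have "(\<Sum>m<N. ?A $$ (k, m) * adj_mat ?A $$ (m, l)) = (?A * adj_mat ?A) $$ (k, l)"
    using k assms(2) adj_mat(1)[OF green_mat_carrier, of N J x z]
    by (auto simp: scalar_prod_def lessThan_atLeast0 carrier_matD[OF green_mat_carrier] intro!: sum.cong)
  also have "\<dots> = det ?A * (if k = l then 1 else 0)"
    using k assms(2) by (simp add: adj_mat(2)[OF green_mat_carrier])
  finally have "(\<Sum>m<N. ?A $$ (k, m) * green N J x z l m) = (if k = l then 1 else 0)"
    using det_green_mat_nonzero[OF assms(1), of N J x]
    by (simp add: green_def flip: sum_divide_distrib)
  then show "(\<Sum>j\<in>J. cnj (x j k) * app N x (green N J x z l) j) - z * green N J x z l k =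
      (if k = l then 1 else 0)"
    using k by (simp add: green_mat_row_sum)
qed

definition green_app :: "nat \<Rightarrow> nat set \<Rightarrow> (nat \<Rightarrow> nat \<Rightarrow> complex) \<Rightarrow> complex \<Rightarrow> (nat \<Rightarrow> complex) \<Rightarrow> nat \<Rightarrow> complex" where
  "green_app N J x z f k = (\<Sum>l<N. f l * green N J x z l k)"

lemma green_app_resolves:
  assumes "0 < Im z"
  shows "resolves N J x z f (green_app N J x z f)"
proof -
  have "resolves N J x z (\<lambda>k. \<Sum>l<N. f l * (if k = l then 1 else 0)) (green_app N J x z f)"
    unfolding green_app_def using green_resolves[OF assms] by (intro resolves_sum) auto
  then show ?thesis
    by (simp add: resolves_def if_distrib cong: if_cong)
qed

definition green_trace :: "nat \<Rightarrow> nat set \<Rightarrow> (nat \<Rightarrow> nat \<Rightarrow> complex) \<Rightarrow> complex \<Rightarrow> complex" where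
  "green_trace N J x z = (\<Sum>l<N. green N J x z l l)"

text \<open>The quadratic form of the resolvent at the vector \<open>cnj \<circ> x i\<close>.\<close>

definition green_form :: "nat \<Rightarrow> nat set \<Rightarrow> (nat \<Rightarrow> nat \<Rightarrow> complex) \<Rightarrow> complex \<Rightarrow> nat \<Rightarrow> complex" where
  "green_form N J x z i = app N x (green_app N J x z (\<lambda>l. cnj (x i l))) i"

lemma app_eq_cip: "app N x g i = cip N (\<lambda>k. cnj (x i k)) g"
  by (simp add: app_def cip_def)

lemma app_cong: "(\<And>k. k < N \<Longrightarrow> g k = h k) \<Longrightarrow> app N x g i = app N x h i"
  by (simp add: app_def)

lemma app_scale: "app N x (\<lambda>k. c * g k) i = c * app N x g i"
  by (simp add: app_def sum_distrib_left ac_simps)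

lemma cip_unit: "l < N \<Longrightarrow> cip N (\<lambda>k. if k = l then 1 else 0) g = g l"
proof -
  assume "l < N"
  have "cip N (\<lambda>k. if k = l then 1 else 0) g = (\<Sum>k<N. if k = l then g k else 0)"
    unfolding cip_def by (intro sum.cong) auto
  with \<open>l < N\<close> show ?thesis by simp
qed

lemma nsq_unit: "l < N \<Longrightarrow> nsq N (\<lambda>k. if k = l then 1 else 0) = 1"
  using cip_self[of N "\<lambda>k. if k = l then 1 else 0"] by (simp add: cip_unit)

text \<open>Sherman-Morrison in vector form: once row \<open>i\<close> is put back, the solution for
  \<open>y_i\<close> without that row has the right-hand side \<open>(1 + s_i) y_i\<close>, which by
  linearity the full resolvent also solves.\<close>

lemma green_app_remove_row:
  assumes "0 < Im z" "finite J" "i \<in> J" "k < N"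
  shows "green_app N (J - {i}) x z (\<lambda>l. cnj (x i l)) k =
    (1 + green_form N (J - {i}) x z i) * green_app N J x z (\<lambda>l. cnj (x i l)) k"
proof -
  let ?y = "\<lambda>l. cnj (x i l)" and ?s = "green_form N (J - {i}) x z i"
  have 1: "resolves N J x z (\<lambda>k. 1 * ?y k + ?s * ?y k) (green_app N (J - {i}) x z ?y)"
    unfolding green_form_def
    by (intro resolves_insert_row green_app_resolves) fact+
  have 2: "resolves N J x z (\<lambda>k. 1 * ?y k + ?s * ?y k)
      (\<lambda>k. 1 * green_app N J x z ?y k + ?s * green_app N J x z ?y k)"
    by (intro resolves_lincomb green_app_resolves assms)
  show ?thesis
    using resolves_unique[OF 1 2 assms(1) refl assms(4)] by (simp add: algebra_simps)
qed

text \<open>Pairing the vector identity with row \<open>i\<close> gives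
  \<open>s = (1 + s) t\<close>, where \<open>t\<close> is the form of the full resolvent. If
  \<open>1 + s\<close> vanished, this would force \<open>s = 0\<close>, a contradiction.\<close>

lemma green_form_remove_row:
  assumes "0 < Im z" "finite J" "i \<in> J"
  shows "1 + green_form N (J - {i}) x z i \<noteq> 0"
    and "green_form N J x z i = 1 - 1 / (1 + green_form N (J - {i}) x z i)"
proof -
  let ?y = "\<lambda>l. cnj (x i l)" and ?s = "green_form N (J - {i}) x z i"
  have eq: "?s = (1 + ?s) * green_form N J x z i"
  proof -
    have "?s = app N x (\<lambda>k. (1 + ?s) * green_app N J x z ?y k) i"
      unfolding green_form_def[of N "J - {i}"]
      by (intro app_cong) (simp add: green_app_remove_row[OF assms] green_form_def)
    then show ?thesis
      by (simp only: app_scale flip: green_form_def)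
  qed
  then show nz: "1 + ?s \<noteq> 0"
    by (metis add_0_right mult_zero_left one_neq_zero)
  show "green_form N J x z i = 1 - 1 / (1 + ?s)"
    using eq nz by (simp add: field_simps)
qed

text \<open>The two resolvents differ by a rank-one matrix, so the traces differ by the single
  number \<open>y^* G_i G y\<close> with \<open>y\<close> a unit vector; each resolvent costs a
  factor \<open>1 / Im z\<close>.\<close>

lemma green_trace_remove_row:
  assumes "0 < Im z" "finite J" "i \<in> J" and "nsq N (x i) = 1"
  shows "cmod (green_trace N (J - {i}) x z - green_trace N J x z) \<le> 1 / (Im z)\<^sup>2"
proof -
  let ?y = "\<lambda>l. cnj (x i l)"
  let ?e = "\<lambda>l k. if k = l then 1 else (0::complex)"
  let ?g = "green_app N J x z ?y"
  let ?h = "green_app N (J - {i}) x z ?g"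
  have diff: "green N (J - {i}) x z l l - green N J x z l l =
      app N x (green N (J - {i}) x z l) i * ?g l" if l: "l < N" for l
  proof -
    let ?g' = "green N (J - {i}) x z l"
    have 1: "resolves N J x z (\<lambda>k. 1 * ?e l k + app N x ?g' i * ?y k) ?g'"
      by (intro resolves_insert_row green_resolves assms l)
    have 2: "resolves N J x z (\<lambda>k. 1 * ?e l k + app N x ?g' i * ?y k)
        (\<lambda>k. 1 * green N J x z l k + app N x ?g' i * ?g k)"
      by (intro resolves_lincomb green_resolves green_app_resolves assms l)
    show ?thesis
      using resolves_unique[OF 1 2 assms(1) refl l] by simp
  qed
  have "green_trace N (J - {i}) x z - green_trace N J x z =
      (\<Sum>l<N. ?g l * app N x (green N (J - {i}) x z l) i)"
    unfolding green_trace_def using diff by (simp flip: sum_subtractf add: mult.commute)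
  also have "\<dots> = app N x ?h i"
    unfolding green_app_def[of N "J - {i}"] app_sum ..
  finally have eq: "green_trace N (J - {i}) x z - green_trace N J x z = cip N ?y ?h"
    by (simp add: app_eq_cip)
  have y: "nsq N ?y = 1"
    using assms(4) by (simp add: nsq_def)
  have "(Im z)\<^sup>2 * ((Im z)\<^sup>2 * nsq N ?h) \<le> (Im z)\<^sup>2 * nsq N ?g"
    by (intro mult_left_mono nsq_resolves_le[OF green_app_resolves] assms) auto
  also have "\<dots> \<le> 1"
    using nsq_resolves_le[OF green_app_resolves[OF assms(1)] assms(1), of N J x ?y] y by simp
  finally have "nsq N ?h \<le> (1 / (Im z)\<^sup>2)\<^sup>2"
    using assms(1) by (simp add: field_simps power2_eq_square)
  then have "(cmod (cip N ?y ?h))\<^sup>2 \<le> (1 / (Im z)\<^sup>2)\<^sup>2"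
    using cip_Cauchy_Schwarz[of N ?y ?h] unfolding y mult_1 by (rule order_trans[rotated])
  then show ?thesis
    unfolding eq by (rule power2_le_imp_le) simp
qed

text \<open>Both sides are the trace of \<open>X_J^* X_J G\<close>, which equals
  \<open>1 + z G\<close> by the resolvent equation.\<close>

lemma sum_green_form:
  assumes "0 < Im z"
  shows "(\<Sum>j\<in>J. green_form N J x z j) = of_nat N + z * green_trace N J x z"
proof -
  have "(\<Sum>j\<in>J. green_form N J x z j) =
      (\<Sum>j\<in>J. \<Sum>l<N. cnj (x j l) * app N x (green N J x z l) j)"
    by (simp add: green_form_def green_app_def[abs_def] app_sum)
  also have "\<dots> = (\<Sum>l<N. \<Sum>j\<in>J. cnj (x j l) * app N x (green N J x z l) j)"
    by (rule sum.swap)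
  also have "\<dots> = (\<Sum>l<N. 1 + z * green N J x z l l)"
  proof (rule sum.cong)
    fix l assume "l \<in> {..<N}"
    with green_resolves[OF assms, of l N J x]
    have "(\<Sum>j\<in>J. cnj (x j l) * app N x (green N J x z l) j) - z * green N J x z l l = 1"
      by (auto simp: resolves_def)
    then show "(\<Sum>j\<in>J. cnj (x j l) * app N x (green N J x z l) j) = 1 + z * green N J x z l l"
      by (simp add: algebra_simps)
  qed simp
  finally show ?thesis
    by (simp add: green_trace_def sum.distrib sum_distrib_left)
qed

lemma nsq_green_le:
  assumes "0 < Im z" "l < N"
  shows "nsq N (green N J x z l) \<le> 1 / (Im z)\<^sup>2"
  using nsq_resolves_le[OF green_resolves[OF assms, of J x] assms(1)] assms
  by (simp add: nsq_unit field_simps)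

text \<open>The diagonal spectral measure at \<open>l\<close> has mean at most 1, hence keeps mass near the origin.\<close>

lemma nsq_green_ge:
  assumes "0 < Im z" "l < N" "cmod z \<le> 5" and col: "(\<Sum>j\<in>J. (cmod (x j l))\<^sup>2) \<le> 1"
  shows "1 / 256 \<le> nsq N (green N J x z l)"
proof (rule ccontr)
  let ?e = "\<lambda>k. if k = l then 1 else (0::complex)"
  let ?g = "green N J x z l"
  \<comment> \<open>A small column has \<open>|g(l)| \<le> 1/16\<close>, hence by the energy
    identity Gram energy at most \<open>21/256 < 1/4\<close>. The equation at \<open>l\<close> would
    then give \<open>1 \<le> 1/2 + 5/16\<close>.\<close>
  assume "\<not> ?thesis"
  then have small: "nsq N ?g \<le> (1/16)\<^sup>2"
    by (simp add: power2_eq_square)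
  have res: "resolves N J x z ?e ?g"
    using assms by (intro green_resolves)
  have gl: "cmod (?g l) \<le> 1/16"
    by (rule power2_le_imp_le[OF order_trans[OF cmod_le_nsq[OF assms(2)] small]]) simp
  have cipge: "cip N ?g ?e = cnj (?g l)"
    using cip_unit[OF assms(2), of ?g] by (subst cip_commute) simp
  have "(\<Sum>j\<in>J. (cmod (app N x ?g j))\<^sup>2) = Re (cnj (?g l) + z * of_real (nsq N ?g))"
    using resolves_energy[OF res] unfolding cipge by (simp add: algebra_simps flip: of_real_power of_real_sum)
  also have "\<dots> \<le> cmod (cnj (?g l) + z * of_real (nsq N ?g))"
    by (rule complex_Re_le_cmod)
  also have "\<dots> \<le> cmod (?g l) + cmod z * nsq N ?g"
    by (rule order_trans[OF norm_triangle_ineq]) (simp add: norm_mult)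
  also have "\<dots> \<le> 1/16 + 5 * (1/16)\<^sup>2"
    using gl small assms(3) by (intro add_mono mult_mono) auto
  finally have energy: "(\<Sum>j\<in>J. (cmod (app N x ?g j))\<^sup>2) \<le> (1/2)\<^sup>2"
    by (simp add: power2_eq_square)
  have "(\<Sum>j\<in>J. cnj (x j l) * app N x ?g j) - z * ?g l = 1"
    using res assms(2) by (auto simp: resolves_def)
  then have one: "1 \<le> cmod (\<Sum>j\<in>J. cnj (x j l) * app N x ?g j) + cmod z * cmod (?g l)"
    by (metis norm_mult norm_one norm_triangle_ineq4)
  have "(cmod (\<Sum>j\<in>J. cnj (x j l) * app N x ?g j))\<^sup>2 \<le>
      (\<Sum>j\<in>J. cmod (x j l) * cmod (app N x ?g j))\<^sup>2"
    by (intro power_mono order_trans[OF norm_sum]) (auto simp: norm_mult)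
  also have "\<dots> \<le> (\<Sum>j\<in>J. (cmod (x j l))\<^sup>2) * (\<Sum>j\<in>J. (cmod (app N x ?g j))\<^sup>2)"
    by (rule Cauchy_Schwarz_ineq_sum)
  also have "\<dots> \<le> 1 * (1/2)\<^sup>2"
    using energy col by (intro mult_mono) (auto intro: sum_nonneg)
  finally have "(cmod (\<Sum>j\<in>J. cnj (x j l) * app N x ?g j))\<^sup>2 \<le> (1/2)\<^sup>2"
    unfolding mult_1 .
  then have "cmod (\<Sum>j\<in>J. cnj (x j l) * app N x ?g j) \<le> 1/2"
    by (rule power2_le_imp_le) simp
  moreover have "cmod z * cmod (?g l) \<le> 5 * (1/16)"
    using gl assms(3) by (intro mult_mono) auto
  ultimately show False
    using one by simp
qed

section \<open>Lower bound for the trace, stability of the self-consistent equation,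
  delocalization\<close>

lemma Im_green_trace_ge:
  assumes "0 < Im z" "cmod z \<le> 5" and "\<And>l. l < N \<Longrightarrow> (\<Sum>j\<in>J. (cmod (x j l))\<^sup>2) \<le> 1"
  shows "Im (green_trace N J x z) \<ge> real N * Im z / 256"
proof -
  have "Im (green N J x z l l) \<ge> Im z / 256" if l: "l < N" for l
  proof -
    have "green N J x z l l = cip N (\<lambda>k. if k = l then 1 else 0) (green N J x z l)"
      using l by (simp add: cip_unit)
    \<comment> \<open>The Ward identity at a unit vector turns the lower bound on the column norm
      into one on the diagonal entry.\<close>
    then have "Im (green N J x z l l) = Im z * nsq N (green N J x z l)"
      using Im_resolves[OF green_resolves[OF assms(1) l]] by simp
    moreover have "Im z * (1/256) \<le> Im z * nsq N (green N J x z l)"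
      using assms l by (intro mult_left_mono nsq_green_ge) auto
    ultimately show ?thesis by simp
  qed
  then have "(\<Sum>l<N. Im z / 256) \<le> (\<Sum>l<N. Im (green N J x z l l))"
    by (intro sum_mono) auto
  then show ?thesis
    by (simp add: green_trace_def)
qed

text \<open>Here \<open>a\<close> stands for \<open>1 + m\<close> and \<open>b i\<close> for
  \<open>1 + s_i\<close>. If \<open>|a| < 1/8\<close>, the average of the \<open>1 / b i\<close> has
  modulus at least \<open>(6/7) / |a| > 48/7\<close>, while \<open>|z (a - 1)|\<close> is at most
  \<open>45/8 < 48/7\<close>.\<close>

lemma self_consistent_stability:
  fixes z a :: complex and b :: "nat \<Rightarrow> complex"
  assumes "cmod z \<le> 5" "0 < N"
    and close: "\<And>i. i < N \<Longrightarrow> cmod (b i - a) \<le> cmod a / 8"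
    and a: "a \<noteq> 0"
    and eq: "(\<Sum>i<N. 1 / b i) = - (z * of_nat N * (a - 1))"
  shows "1 / 8 \<le> cmod a"
proof (rule ccontr)
  assume "\<not> ?thesis"
  then have small: "cmod a < 1/8" by simp
  have apos: "0 < cmod a" using a by simp
  \<comment> \<open>Since the error is relative to \<open>|a|\<close>, \<open>b i\<close> keeps
    \<open>7/8\<close> of that size and \<open>1 / b i\<close> deviates from \<open>1 / a\<close> by
    at most a seventh of its modulus.\<close>
  have each: "cmod (1 / b i - 1 / a) \<le> 1 / (7 * cmod a)" if i: "i < N" for i
  proof -
    have bi: "cmod (b i) \<ge> 7/8 * cmod a"
      using close[OF i] norm_triangle_ineq2[of a "a - b i"] by (simp add: norm_minus_commute)
    then have "b i \<noteq> 0" using apos by auto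
    then have "cmod (1 / b i - 1 / a) = cmod (b i - a) / (cmod a * cmod (b i))"
      using a by (simp add: diff_divide_eq_iff divide_diff_eq_iff norm_mult norm_divide norm_minus_commute
          mult.commute)
    also have "\<dots> \<le> (cmod a / 8) / (cmod a * (7/8 * cmod a))"
      using close[OF i] bi apos by (intro frac_le mult_left_mono) auto
    also have "\<dots> = 1 / (7 * cmod a)"
      using apos by (simp add: field_simps)
    finally show ?thesis .
  qed
  have "of_nat N * (1 / a) = (\<Sum>i<N. 1 / b i) - (\<Sum>i<N. 1 / b i - 1 / a)"
    by (simp add: sum_subtractf)
  then have "cmod (of_nat N * (1 / a)) \<le> cmod (\<Sum>i<N. 1 / b i) + cmod (\<Sum>i<N. 1 / b i - 1 / a)"
    by (metis norm_triangle_ineq4)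
  also have "cmod (\<Sum>i<N. 1 / b i - 1 / a) \<le> real N * (1 / (7 * cmod a))"
    using sum_norm_le[of "{..<N}" "\<lambda>i. 1 / b i - 1 / a" "\<lambda>_. 1 / (7 * cmod a)"] each by simp
  also have "cmod (\<Sum>i<N. 1 / b i) = real N * (cmod z * cmod (a - 1))"
    unfolding eq by (simp add: norm_mult)
  finally have "real N * (1 / cmod a) \<le> real N * (cmod z * cmod (a - 1) + 1 / (7 * cmod a))"
    by (simp add: norm_mult norm_divide algebra_simps)
  then have "1 / cmod a \<le> cmod z * cmod (a - 1) + 1 / (7 * cmod a)"
    using assms(2) by (simp only: mult_le_cancel_left_pos of_nat_0_less_iff)
  moreover have "cmod z * cmod (a - 1) \<le> 5 * (9/8)"
    using assms(1) small norm_triangle_ineq4[of a 1] by (intro mult_mono) auto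
  ultimately have "1 / cmod a \<le> 45/8 + 1 / (7 * cmod a)"
    by simp
  moreover have "1 / cmod a - 1 / (7 * cmod a) = (6/7) * (1 / cmod a)"
    using apos by (simp add: field_simps)
  moreover have "1 / cmod a > 8"
    using small apos by (simp add: field_simps)
  ultimately show False by simp
qed

text \<open>Test the equation for \<open>g = G y_i\<close> with \<open>v = X^* u\<close>, an
  eigenvector of \<open>X^* X\<close>. One side is the conjugate of \<open>E u(i)\<close>, the other
  is \<open>E - z\<close> times the product of \<open>v\<close> and \<open>g\<close>. Cauchy-Schwarz
  with \<open>nsq N v = E\<close> and the Ward identity for \<open>g\<close> finish the
  bound.\<close>

lemma eigenvector_entry_bound:
  assumes "0 < Im z" "i < N" "0 < E"
    and u: "(\<Sum>j<N. (cmod (u j))\<^sup>2) = 1"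
    and eig: "\<And>j. j < N \<Longrightarrow> app N x (\<lambda>k. \<Sum>j<N. cnj (x j k) * u j) j = of_real E * u j"
  shows "E * (cmod (u i))\<^sup>2 * Im z \<le> (cmod (of_real E - z))\<^sup>2 * Im (green_form N {..<N} x z i)"
proof -
  define v where "v k = (\<Sum>j<N. cnj (x j k) * u j)" for k
  let ?y = "\<lambda>l. cnj (x i l)"
  define g where "g = green_app N {..<N} x z ?y"
  have res: "resolves N {..<N} x z ?y g"
    unfolding g_def by (rule green_app_resolves) fact
  have cip_v: "cip N v h = (\<Sum>j<N. cnj (u j) * app N x h j)" for h
  proof -
    have "cip N v h = (\<Sum>k<N. \<Sum>j<N. cnj (u j) * (x j k * h k))"
      by (simp add: cip_def v_def sum_distrib_left sum_distrib_right ac_simps)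
    also have "\<dots> = (\<Sum>j<N. cnj (u j) * app N x h j)"
      by (subst sum.swap) (simp add: app_def sum_distrib_left)
    finally show ?thesis .
  qed
  have app_v: "app N x v j = of_real E * u j" if "j < N" for j
    using eig[OF that] by (simp add: v_def[abs_def])
  have "of_real (nsq N v) = (\<Sum>j<N. cnj (u j) * (of_real E * u j))"
    unfolding cip_self[symmetric] cip_v using app_v by simp
  also have "\<dots> = of_real E * of_real (\<Sum>j<N. (cmod (u j))\<^sup>2)"
    by (simp add: sum_distrib_left complex_norm_square ac_simps del: of_real_power)
  finally have nv: "nsq N v = E"
    unfolding u by (simp flip: of_real_mult)
  have "cip N v ?y = (\<Sum>j<N. cnj (of_real E * u j) * app N x g j) - z * cip N v g"
    using resolves_weak[OF res, of v] app_v by simp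
  also have "(\<Sum>j<N. cnj (of_real E * u j) * app N x g j) = of_real E * cip N v g"
    by (simp add: cip_v sum_distrib_left ac_simps)
  finally have vy: "cip N v ?y = (of_real E - z) * cip N v g"
    by (simp add: algebra_simps)
  have "cip N v ?y = cnj (app N x v i)"
    by (simp add: cip_def app_def ac_simps)
  then have "cmod ((of_real E - z) * cip N v g) = E * cmod (u i)"
    using vy app_v[OF assms(2)] assms(3) by (simp add: norm_mult)
  then have "(E * cmod (u i))\<^sup>2 = (cmod (of_real E - z))\<^sup>2 * (cmod (cip N v g))\<^sup>2"
    by (metis norm_mult power_mult_distrib)
  also have "\<dots> \<le> (cmod (of_real E - z))\<^sup>2 * (E * nsq N g)"
    using cip_Cauchy_Schwarz[of N v g] nv by (intro mult_left_mono) auto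
  finally have "E * (E * (cmod (u i))\<^sup>2) \<le> E * ((cmod (of_real E - z))\<^sup>2 * nsq N g)"
    by (simp add: power2_eq_square ac_simps)
  then have "E * (cmod (u i))\<^sup>2 \<le> (cmod (of_real E - z))\<^sup>2 * nsq N g"
    using assms(3) by simp
  then have "E * (cmod (u i))\<^sup>2 * Im z \<le> (cmod (of_real E - z))\<^sup>2 * nsq N g * Im z"
    using assms(1) by (intro mult_right_mono) auto
  moreover have "Im (green_form N {..<N} x z i) = Im z * nsq N g"
    unfolding green_form_def app_eq_cip g_def[symmetric] by (rule Im_resolves[OF res])
  ultimately show ?thesis
    by (simp add: ac_simps)
qed

text \<open>The value 4096 is chosen so that two errors of size \<open>\<eta> / 4096\<close> add up
  to one eighth of the lower bound \<open>\<eta> / 256\<close> for \<open>|1 + m|\<close>, as the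
  stability lemma requires.\<close>

lemma eigenvector_delocalized:
  assumes N: "0 < N" and unimod: "\<And>j k. j < N \<Longrightarrow> k < N \<Longrightarrow> (cmod (x j k))\<^sup>2 = 1 / real N"
    and \<eta>: "0 < \<eta>" "\<eta> \<le> 1 / 2" "1 / (real N * \<eta>\<^sup>2) \<le> \<eta> / 4096"
    and F: "0 \<le> F" "F \<le> 4" and E: "0 < E" "\<bar>E - F\<bar> \<le> \<eta>"
    and close: "\<And>i. i < N \<Longrightarrow> cmod (green_form N ({..<N} - {i}) x (Complex F \<eta>) i -
        green_trace N ({..<N} - {i}) x (Complex F \<eta>) / of_nat N) \<le> \<eta> / 4096"
    and u: "(\<Sum>j<N. (cmod (u j))\<^sup>2) = 1"
    and eig: "\<And>j. j < N \<Longrightarrow> app N x (\<lambda>k. \<Sum>j<N. cnj (x j k) * u j) j = of_real E * u j"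
    and i: "i < N"
  shows "E * (cmod (u i))\<^sup>2 \<le> 20 * \<eta>"
proof -
  define z where "z = Complex F \<eta>"
  define m where "m = green_trace N {..<N} x z / of_nat N"
  define b where "b j = 1 + green_form N ({..<N} - {j}) x z j" for j
  have z: "0 < Im z" "Im z = \<eta>"
    using \<eta> by (auto simp: z_def)
  have cz: "cmod z \<le> 5"
    using cmod_le[of z] F \<eta> by (simp add: z_def)
  have row: "nsq N (x j) = 1" if "j < N" for j
    using that N unimod by (simp add: nsq_def)
  have "Im m \<ge> \<eta> / 256"
    using Im_green_trace_ge[OF z(1) cz, where N=N and J="{..<N}" and x=x] unimod N z(2)
    by (simp add: m_def Im_divide_of_nat field_simps)
  then have Ima: "cmod (1 + m) \<ge> \<eta> / 256"
    using abs_Im_le_cmod[of "1 + m"] by simp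
  have bclose: "cmod (b j - (1 + m)) \<le> cmod (1 + m) / 8" if j: "j < N" for j
  proof -
    \<comment> \<open>The comparison of \<open>s_j\<close> with \<open>m\<close> passes through the
      trace without row \<open>j\<close>: one error comes from removing the row, the other from
      \<open>close\<close>.\<close>
    let ?T = "green_trace N ({..<N} - {j}) x z"
    have "cmod (?T / of_nat N - m) = cmod (?T - green_trace N {..<N} x z) / real N"
      by (simp add: m_def norm_divide flip: diff_divide_distrib)
    also have "\<dots> \<le> (1 / \<eta>\<^sup>2) / real N"
      using green_trace_remove_row[OF z(1), of "{..<N}" j N x] row j z(2)
      by (intro divide_right_mono) auto
    also have "\<dots> \<le> \<eta> / 4096"
      using \<eta>(3) by (simp add: field_simps)
    finally have "cmod (?T / of_nat N - m) \<le> \<eta> / 4096" .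
    moreover have "cmod (green_form N ({..<N} - {j}) x z j - ?T / of_nat N) \<le> \<eta> / 4096"
      using close[OF j] by (simp add: z_def)
    ultimately have "cmod ((green_form N ({..<N} - {j}) x z j - ?T / of_nat N) + (?T / of_nat N - m)) \<le>
        \<eta> / 4096 + \<eta> / 4096"
      by (intro norm_triangle_mono)
    then show ?thesis
      using Ima by (simp add: b_def)
  qed
  have form: "green_form N {..<N} x z j = 1 - 1 / b j" if "j < N" for j
    using green_form_remove_row(2)[OF z(1), of "{..<N}" j N x] that by (simp add: b_def)
  have "(\<Sum>j<N. green_form N {..<N} x z j) = of_nat N - (\<Sum>j<N. 1 / b j)"
    using form by (simp add: sum_subtractf)
  then have eq: "(\<Sum>j<N. 1 / b j) = - (z * of_nat N * ((1 + m) - 1))"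
    using sum_green_form[OF z(1), of N "{..<N}" x] N by (simp add: m_def algebra_simps add_eq_0_iff)
  have "1 + m \<noteq> 0"
    using Ima \<eta>(1) by auto
  from self_consistent_stability[OF cz N bclose this eq]
  have a: "1 / 8 \<le> cmod (1 + m)" .
  \<comment> \<open>\<open>7/64\<close> is \<open>7/8\<close> of \<open>1/8\<close>, so
    \<open>|1 / b i| \<le> 64/7 < 10\<close>.\<close>
  have bi: "cmod (b i) \<ge> 7 / 64"
    using bclose[OF i] a norm_triangle_ineq2[of "1 + m" "1 + m - b i"] by (simp add: norm_minus_commute)
  have "Im (green_form N {..<N} x z i) \<le> cmod (1 / b i)"
    using abs_Im_le_cmod[of "1 / b i"] by (simp add: form[OF i])
  also have "\<dots> \<le> 10"
    using frac_le[of 1 1 "7 / 64" "cmod (b i)"] bi by (simp add: norm_divide)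
  finally have Imt: "Im (green_form N {..<N} x z i) \<le> 10" .
  \<comment> \<open>The real and the imaginary part of \<open>E - z\<close> contribute at most
    \<open>\<eta>\<close> squared each. Together with the bound 10 this produces the constant
    20.\<close>
  have dist: "(cmod (of_real E - z))\<^sup>2 \<le> 2 * \<eta>\<^sup>2"
    using E(2) \<eta>(1) abs_le_square_iff[of "E - F" \<eta>] by (simp add: cmod_power2 z_def)
  have "E * (cmod (u i))\<^sup>2 * \<eta> \<le> (cmod (of_real E - z))\<^sup>2 * Im (green_form N {..<N} x z i)"
    using eigenvector_entry_bound[OF z(1) i E(1) u eig] z(2) by simp
  also have "\<dots> \<le> (cmod (of_real E - z))\<^sup>2 * 10"
    using Imt by (intro mult_left_mono) auto
  also have "\<dots> \<le> 2 * \<eta>\<^sup>2 * 10"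
    using dist by (intro mult_right_mono) auto
  finally have "(E * (cmod (u i))\<^sup>2) * \<eta> \<le> (20 * \<eta>) * \<eta>"
    by (simp add: power2_eq_square)
  then show ?thesis
    using \<eta>(1) by simp
qed

section \<open>Power sums and matched pairs\<close>

text \<open>Test the relations against the polynomial that vanishes on \<open>S\<close> except at
  \<open>v\<close>; its degree is at most \<open>card S - 1 \<le> d\<close>.\<close>

lemma vandermonde_kernel:
  fixes c :: "real \<Rightarrow> real"
  assumes "finite S" "card S \<le> Suc d" and zero: "\<And>q. q \<le> d \<Longrightarrow> (\<Sum>v\<in>S. c v * v ^ q) = 0" and "v \<in> S"
  shows "c v = 0"
proof -
  define p where "p = (\<Prod>w\<in>S - {v}. [:- w, 1:])"
  have "degree p \<le> (\<Sum>w\<in>S - {v}. degree [:- w, 1:])"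
    unfolding p_def using degree_prod_sum_le[of "S - {v}" "\<lambda>w. [:- w, 1:]"] assms(1) by (simp add: comp_def)
  also have "\<dots> \<le> d"
    using assms by simp
  finally have deg: "degree p \<le> d" .
  have pv: "poly p w = (if w = v then poly p v else 0)" if "w \<in> S" for w
    using that assms(1) by (auto simp: p_def poly_prod prod_zero_iff)
  have "0 = (\<Sum>q\<le>degree p. coeff p q * (\<Sum>w\<in>S. c w * w ^ q))"
    using zero deg by simp
  also have "\<dots> = (\<Sum>w\<in>S. c w * poly p w)"
    unfolding poly_altdef sum_distrib_left by (subst sum.swap) (simp add: ac_simps)
  also have "\<dots> = (\<Sum>w\<in>S. if w = v then c v * poly p v else 0)"
    using pv by (intro sum.cong) auto
  also have "\<dots> = c v * poly p v"
    using assms by simp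
  finally have "c v * poly p v = 0" by simp
  moreover have "poly p v \<noteq> 0"
    using assms(1) by (simp add: p_def poly_prod)
  ultimately show ?thesis by simp
qed

text \<open>The differences of multiplicities are annihilated by all powers up to \<open>d\<close>,
  and they live on at most \<open>d\<close> distinct values, so the Vandermonde lemma makes them
  vanish.\<close>

lemma power_sums_eq_imp_mset_eq:
  fixes xs ys :: "real list"
  assumes "length xs = length ys" "length xs + length ys \<le> d"
    and "\<And>q. 1 \<le> q \<Longrightarrow> q \<le> d \<Longrightarrow> (\<Sum>x\<leftarrow>xs. x ^ q) = (\<Sum>y\<leftarrow>ys. y ^ q)"
  shows "mset xs = mset ys"
proof -
  let ?S = "set xs \<union> set ys"
  have count: "(\<Sum>x\<leftarrow>zs. f x) = (\<Sum>v\<in>?S. real (count (mset zs) v) * f v)" if "set zs \<subseteq> ?S" for zs f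
    using that
  proof (induction zs)
    case (Cons z zs)
    have "(\<Sum>v\<in>?S. real (count (mset (z # zs)) v) * f v) =
        (\<Sum>v\<in>?S. real (count (mset zs) v) * f v + (if v = z then f z else 0))"
      by (intro sum.cong) (auto simp: algebra_simps)
    with Cons show ?case
      by (simp add: sum.distrib)
  qed simp
  \<comment> \<open>Exponent 0, absent from the hypothesis, is supplied by the equal
    lengths.\<close>
  have eq: "(\<Sum>x\<leftarrow>xs. x ^ q) = (\<Sum>y\<leftarrow>ys. y ^ q)" if "q \<le> d" for q
    using assms that by (cases "q = 0") (simp_all add: sum_list_triv)
  have card: "card ?S \<le> Suc d"
    using card_Un_le[of "set xs" "set ys"] card_length[of xs] card_length[of ys] assms(2) by linarith
  have zero: "(\<Sum>v\<in>?S. (real (count (mset xs) v) - real (count (mset ys) v)) * v ^ q) = 0"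
    if "q \<le> d" for q
    using eq[OF that] by (simp add: count left_diff_distrib sum_subtractf)
  have same: "real (count (mset xs) v) - real (count (mset ys) v) = 0" if "v \<in> ?S" for v
    by (rule vandermonde_kernel[OF _ card zero that]) simp
  show ?thesis
  proof (intro multiset_eqI)
    fix v
    show "count (mset xs) v = count (mset ys) v"
      using same[of v]
      by (cases "v \<in> ?S") (auto, metis count_mset_0_iff)
  qed
qed

section \<open>Matchings of four off-diagonal index pairs\<close>

lemma pair_mset_eq_iff:
  "{#x, y#} = {#x', y'#} \<longleftrightarrow> x = x' \<and> y = y' \<or> x = y' \<and> y = x'"
  by (auto simp: add_eq_conv_ex)

lemma triple_mset_eqD:
  assumes "{#x, y, z#} = {#x', y', z'#}"
  shows "x = x' \<and> {#y, z#} = {#y', z'#} \<or> x = y' \<and> {#y, z#} = {#x', z'#} \<or>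
    x = z' \<and> {#y, z#} = {#x', y'#}"
proof -
  have "x \<in># {#x', y', z'#}"
    using assms by (metis union_single_eq_member)
  then consider "x = x'" | "x = y'" | "x = z'" by auto
  then show ?thesis
    by cases (use assms in \<open>simp_all add: add_mset_commute\<close>)
qed

lemma quadruple_mset_eqD:
  assumes "{#x, y, z, w#} = {#x', y', z', w'#}" and "x \<noteq> x'"
  shows "x = y' \<and> {#y, z, w#} = {#x', z', w'#} \<or> x = z' \<and> {#y, z, w#} = {#x', y', w'#} \<or>
    x = w' \<and> {#y, z, w#} = {#x', y', z'#}"
proof -
  have "x \<in># {#x', y', z', w'#}"
    using assms by (metis union_single_eq_member)
  then consider "x = y'" | "x = z'" | "x = w'" using assms(2) by auto
  then show ?thesis
    by cases (use assms in \<open>simp_all add: add_mset_commute\<close>)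
qed

text \<open>Once \<open>p\<close> and \<open>p'\<close> are fixed, only boundedly many
  \<open>r\<close> and \<open>r'\<close> are covered, so a sum over covered pairs reduces to a sum
  over \<open>p\<close> and \<open>p'\<close>.\<close>

definition covers :: "'a \<times> 'a \<Rightarrow> 'a \<times> 'a \<Rightarrow> 'a \<times> 'a \<Rightarrow> 'a \<times> 'a \<Rightarrow> bool" where
  "covers p p' r r' \<longleftrightarrow> {fst r, snd r, fst r', snd r'} \<subseteq> {fst p, snd p, fst p', snd p'}"

text \<open>The matching permutes four positions, without fixed points since the pairs are
  off-diagonal, so it is a four-cycle or a product of two transpositions. Two non-adjacent positions
  of the cycle, or one position from each transposition, already carry all the indices, and so do
  the remaining two.\<close>

lemma derangement_covers:
  fixes p1 p2 p3 p4 :: "'a \<times> 'a"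
  assumes "mset [fst p1, fst p2, snd p3, snd p4] = mset [snd p1, snd p2, fst p3, fst p4]"
    and "fst p1 \<noteq> snd p1" "fst p2 \<noteq> snd p2" "fst p3 \<noteq> snd p3" "fst p4 \<noteq> snd p4"
  shows "covers p1 p2 p3 p4 \<and> covers p3 p4 p1 p2 \<or>
    covers p1 p3 p2 p4 \<and> covers p2 p4 p1 p3 \<or>
    covers p1 p4 p2 p3 \<and> covers p2 p3 p1 p4"
proof -
  \<comment> \<open>The last two pairs are named in reverse order because their components enter the
    matching on opposite sides.\<close>
  obtain a a' b b' c c' d d' where p: "p1 = (a, a')" "p2 = (b, b')" "p3 = (c', c)" "p4 = (d', d)"
    by (metis surj_pair)
  have ne: "a \<noteq> a'" "b \<noteq> b'" "c \<noteq> c'" "d \<noteq> d'"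
    using assms by (auto simp: p)
  have "{#a, b, c, d#} = {#a', b', c', d'#}"
    using assms(1) by (simp add: p)
  from quadruple_mset_eqD[OF this ne(1)] show ?thesis
    using ne by (safe dest!: triple_mset_eqD) (auto simp: pair_mset_eq_iff covers_def p)
qed

text \<open>The four components of \<open>r\<close> and \<open>r'\<close> each range over at most
  four values, whence 256 choices.\<close>

lemma sum_covers_le:
  fixes e :: "'a \<times> 'a \<Rightarrow> real"
  assumes "finite P" and "\<And>p. 0 \<le> e p"
  shows "(\<Sum>p\<in>P. \<Sum>p'\<in>P. \<Sum>r\<in>P. \<Sum>r'\<in>P. of_bool (covers p p' r r') * (e p * e p')) \<le> 256 * (sum e P)\<^sup>2"
proof -
  have "(\<Sum>r\<in>P. \<Sum>r'\<in>P. of_bool (covers p p' r r') * (e p * e p')) \<le> 256 * (e p * e p')" for p p'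
  proof -
    define V where "V = {fst p, snd p, fst p', snd p'}"
    have V: "finite V" "card V \<le> 4"
      using card_length[of "[fst p, snd p, fst p', snd p']"] by (simp_all add: V_def)
    have "(\<Sum>r\<in>P. \<Sum>r'\<in>P. of_bool (covers p p' r r') :: real) = real (card {s \<in> P \<times> P. covers p p' (fst s) (snd s)})"
      unfolding sum.cartesian_product case_prod_beta using assms(1)
      by (subst sum_of_bool_eq) (auto intro!: arg_cong[where f = card])
    also have "card {s \<in> P \<times> P. covers p p' (fst s) (snd s)} \<le> card ((V \<times> V) \<times> (V \<times> V))"
      using V(1) by (intro card_mono) (auto simp: covers_def mem_Times_iff simp flip: V_def)
    also have "\<dots> \<le> (4 * 4) * (4 * 4)"
      unfolding card_cartesian_product
      by (intro mult_le_mono V)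
    finally have "(\<Sum>r\<in>P. \<Sum>r'\<in>P. of_bool (covers p p' r r') :: real) \<le> 256"
      by simp
    then have "(\<Sum>r\<in>P. \<Sum>r'\<in>P. of_bool (covers p p' r r') :: real) * (e p * e p') \<le> 256 * (e p * e p')"
      using assms(2) by (intro mult_right_mono) auto
    then show ?thesis
      by (simp add: sum_distrib_right)
  qed
  then have "(\<Sum>p\<in>P. \<Sum>p'\<in>P. \<Sum>r\<in>P. \<Sum>r'\<in>P. of_bool (covers p p' r r') * (e p * e p')) \<le>
      (\<Sum>p\<in>P. \<Sum>p'\<in>P. 256 * (e p * e p'))"
    by (intro sum_mono)
  also have "\<dots> = 256 * (sum e P)\<^sup>2"
    unfolding power2_eq_square sum_product by (simp only: sum_distrib_left)
  finally show ?thesis .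
qed

text \<open>For every matched quadruple, AM-GM is applied along the splitting from
  \<open>derangement_covers\<close>, so that each resulting product of two squares belongs to a pair
  covering the other two. There are three splittings, hence \<open>768 = 3 * 256\<close>.\<close>

lemma sum_matched_le:
  fixes c :: "'a \<times> 'a \<Rightarrow> real"
  assumes "finite P" and c: "\<And>p. 0 \<le> c p" and off: "\<And>p. p \<in> P \<Longrightarrow> fst p \<noteq> snd p"
    and R: "\<And>p1 p2 p3 p4. R p1 p2 p3 p4 \<Longrightarrow>
      mset [fst p1, fst p2, snd p3, snd p4] = mset [snd p1, snd p2, fst p3, fst p4]"
  shows "(\<Sum>p1\<in>P. \<Sum>p2\<in>P. \<Sum>p3\<in>P. \<Sum>p4\<in>P. of_bool (R p1 p2 p3 p4) * (c p1 * c p2 * c p3 * c p4)) \<le>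
    768 * (\<Sum>p\<in>P. (c p)\<^sup>2)\<^sup>2"
proof -
  define e where "e p = (c p)\<^sup>2" for p
  define h where "h p q r s = of_bool (covers p q r s) * (e p * e q)" for p q r s
  have h0: "0 \<le> h p q r s" for p q r s
    by (simp add: h_def e_def)
  have amgm: "c p1 * c p2 * c p3 * c p4 \<le> (e p1 * e p2 + e p3 * e p4) / 2" for p1 p2 p3 p4
    using sum_squares_bound[of "c p1 * c p2" "c p3 * c p4"] by (simp add: e_def power_mult_distrib ac_simps)
  have "of_bool (R p1 p2 p3 p4) * (c p1 * c p2 * c p3 * c p4) \<le>
      (h p1 p2 p3 p4 + h p3 p4 p1 p2 + h p1 p3 p2 p4 + h p2 p4 p1 p3 + h p1 p4 p2 p3 + h p2 p3 p1 p4) / 2"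
    if "p1 \<in> P" "p2 \<in> P" "p3 \<in> P" "p4 \<in> P" for p1 p2 p3 p4
  proof (cases "R p1 p2 p3 p4")
    case True
    from derangement_covers[OF R[OF True] off off off off] that
    consider "covers p1 p2 p3 p4" "covers p3 p4 p1 p2" | "covers p1 p3 p2 p4" "covers p2 p4 p1 p3"
      | "covers p1 p4 p2 p3" "covers p2 p3 p1 p4"
      by blast
    then show ?thesis
    proof cases
      case 1
      then have "(e p1 * e p2 + e p3 * e p4) = h p1 p2 p3 p4 + h p3 p4 p1 p2" by (simp add: h_def)
      then show ?thesis
        using amgm[of p1 p2 p3 p4] True h0[of p1 p3 p2 p4] h0[of p2 p4 p1 p3] h0[of p1 p4 p2 p3] h0[of p2 p3 p1 p4]
        by simp
    next
      case 2
      then have "(e p1 * e p3 + e p2 * e p4) = h p1 p3 p2 p4 + h p2 p4 p1 p3" by (simp add: h_def)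
      then show ?thesis
        using amgm[of p1 p3 p2 p4] True h0[of p1 p2 p3 p4] h0[of p3 p4 p1 p2] h0[of p1 p4 p2 p3] h0[of p2 p3 p1 p4]
        by (simp add: ac_simps)
    next
      case 3
      then have "(e p1 * e p4 + e p2 * e p3) = h p1 p4 p2 p3 + h p2 p3 p1 p4" by (simp add: h_def)
      then show ?thesis
        using amgm[of p1 p4 p2 p3] True h0[of p1 p2 p3 p4] h0[of p3 p4 p1 p2] h0[of p1 p3 p2 p4] h0[of p2 p4 p1 p3]
        by (simp add: ac_simps)
    qed
  qed (simp add: h0)
  then have "(\<Sum>p1\<in>P. \<Sum>p2\<in>P. \<Sum>p3\<in>P. \<Sum>p4\<in>P. of_bool (R p1 p2 p3 p4) * (c p1 * c p2 * c p3 * c p4)) \<le>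
      (\<Sum>p1\<in>P. \<Sum>p2\<in>P. \<Sum>p3\<in>P. \<Sum>p4\<in>P.
        (h p1 p2 p3 p4 + h p3 p4 p1 p2 + h p1 p3 p2 p4 + h p2 p4 p1 p3 + h p1 p4 p2 p3 + h p2 p3 p1 p4) / 2)"
    by (intro sum_mono)
  \<comment> \<open>The six terms are relabellings of one fourfold sum, and AM-GM contributes the
    factor one half.\<close>
  also have "\<dots> = 3 * (\<Sum>p\<in>P. \<Sum>q\<in>P. \<Sum>r\<in>P. \<Sum>s\<in>P. h p q r s)" (is "_ = 3 * ?H")
  proof -
    have "(\<Sum>p1\<in>P. \<Sum>p2\<in>P. \<Sum>p3\<in>P. \<Sum>p4\<in>P. h p3 p4 p1 p2) = ?H"
      by (simp add: sum.cartesian_product)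
         (rule sum.reindex_bij_witness[where i="\<lambda>(a,b,c,d). (c,d,a,b)" and j="\<lambda>(a,b,c,d). (c,d,a,b)"]; auto)
    moreover have "(\<Sum>p1\<in>P. \<Sum>p2\<in>P. \<Sum>p3\<in>P. \<Sum>p4\<in>P. h p1 p3 p2 p4) = ?H"
      by (simp add: sum.cartesian_product)
         (rule sum.reindex_bij_witness[where i="\<lambda>(a,b,c,d). (a,c,b,d)" and j="\<lambda>(a,b,c,d). (a,c,b,d)"]; auto)
    moreover have "(\<Sum>p1\<in>P. \<Sum>p2\<in>P. \<Sum>p3\<in>P. \<Sum>p4\<in>P. h p2 p4 p1 p3) = ?H"
      by (simp add: sum.cartesian_product)
         (rule sum.reindex_bij_witness[where i="\<lambda>(a,b,c,d). (c,a,d,b)" and j="\<lambda>(a,b,c,d). (b,d,a,c)"]; auto)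
    moreover have "(\<Sum>p1\<in>P. \<Sum>p2\<in>P. \<Sum>p3\<in>P. \<Sum>p4\<in>P. h p1 p4 p2 p3) = ?H"
      by (simp add: sum.cartesian_product)
         (rule sum.reindex_bij_witness[where i="\<lambda>(a,b,c,d). (a,c,d,b)" and j="\<lambda>(a,b,c,d). (a,d,b,c)"]; auto)
    moreover have "(\<Sum>p1\<in>P. \<Sum>p2\<in>P. \<Sum>p3\<in>P. \<Sum>p4\<in>P. h p2 p3 p1 p4) = ?H"
      by (simp add: sum.cartesian_product)
         (rule sum.reindex_bij_witness[where i="\<lambda>(a,b,c,d). (c,a,b,d)" and j="\<lambda>(a,b,c,d). (b,c,a,d)"]; auto)
    ultimately show ?thesis
      by (simp add: sum.distrib flip: sum_divide_distrib)
  qed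
  also have "\<dots> \<le> 3 * (256 * (sum e P)\<^sup>2)"
    unfolding h_def using assms(1) by (intro mult_left_mono sum_covers_le) (auto simp: e_def)
  finally show ?thesis
    by (simp add: e_def)
qed

section \<open>Characters of the torus\<close>

text \<open>Haar measure of the torus. The closed interval fits the fundamental theorem of calculus
  and contains the half-open one carrying the phase law.\<close>

definition unit_lebesgue :: "real measure" where
  "unit_lebesgue = density lborel (\<lambda>x. ennreal (indicator {0..1} x))"

lemma sets_unit_lebesgue [simp, measurable_cong]: "sets unit_lebesgue = sets borel"
  by (simp add: unit_lebesgue_def)

interpretation unit_lebesgue: prob_space unit_lebesgue
  by (rule prob_spaceI) (simp add: unit_lebesgue_def emeasure_density ennreal_indicator)

lemma integral_cis_unit_lebesgue:
  fixes n :: int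
  shows "(\<integral>x. cis (2 * pi * (x * of_int n)) \<partial>unit_lebesgue) = of_bool (n = 0)"
proof (cases "n = 0")
  case False
  let ?c = "2 * pi * of_int n"
  have "(\<integral>x. cis (2 * pi * (x * of_int n)) \<partial>unit_lebesgue) =
      (\<integral>x. indicator {0..1} x *\<^sub>R cis (?c * x) \<partial>lborel)"
    unfolding unit_lebesgue_def
    by (subst integral_density)
       (auto simp: ac_simps cis_conv_exp intro!: measurable_compose[OF _ borel_measurable_exp])
  also have "\<dots> = cis (?c * 1) / (\<i> * of_real ?c) - cis (?c * 0) / (\<i> * of_real ?c)"
  proof (rule integral_FTC_Icc)
    fix x :: real
    show "((\<lambda>x. cis (?c * x) / (\<i> * of_real ?c)) has_vector_derivative cis (?c * x)) (at x within {0..1})"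
    proof -
      have "((\<lambda>w. exp (\<i> * of_real ?c * w) / (\<i> * of_real ?c)) has_field_derivative
          exp (\<i> * of_real ?c * of_real x)) (at (of_real x))"
        using False by (auto intro!: derivative_eq_intros)
      from has_vector_derivative_real_field[OF this, of "{0..1}"] show ?thesis
        by (simp add: cis_conv_exp mult.assoc)
    qed
  next
    show "continuous_on {0..1} (\<lambda>x. cis (?c * x))"
      by (intro continuous_intros)
  qed simp
  also have "cis (?c * 1) = 1"
    by (simp add: complex_eq_iff cos_int_2pin sin_int_2pin)
  finally show ?thesis
    using False by simp
qed (use unit_lebesgue.prob_space in simp)

text \<open>The character with frequency vector \<open>n\<close>. The coordinate type is generic
  because the coordinates later are pairs of a row and a degree.\<close>

definition torus_char :: "'q set \<Rightarrow> ('q \<Rightarrow> int) \<Rightarrow> ('q \<Rightarrow> real) \<Rightarrow> complex" where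
  "torus_char Q n w = cis (2 * pi * (\<Sum>q\<in>Q. w q * of_int (n q)))"

lemma norm_torus_char [simp]: "cmod (torus_char Q n w) = 1"
  by (simp add: torus_char_def)

lemma torus_char_eq_prod: "torus_char Q n w = (\<Prod>q\<in>Q. cis (2 * pi * (w q * of_int (n q))))"
  unfolding torus_char_def sum_distrib_left
  by (induction Q rule: infinite_finite_induct) (simp_all add: cis_mult[symmetric])

lemma torus_char_add: "torus_char Q n w * torus_char Q m w = torus_char Q (\<lambda>q. n q + m q) w"
  by (simp add: torus_char_def cis_mult algebra_simps sum.distrib)

lemma torus_char_diff: "torus_char Q n w * cnj (torus_char Q m w) = torus_char Q (\<lambda>q. n q - m q) w"
  by (simp add: torus_char_def cis_cnj cis_mult algebra_simps sum_subtractf sum.distrib)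

lemma borel_measurable_torus_char:
  assumes "finite Q" and "\<And>q. q \<in> Q \<Longrightarrow> sets (M q) = sets borel"
  shows "torus_char Q n \<in> borel_measurable (PiM Q M)"
proof -
  have "(\<lambda>w. w q) \<in> borel_measurable (PiM Q M)" if "q \<in> Q" for q
    using measurable_component_singleton[OF that, of M] assms(2)[OF that]
    by (simp cong: measurable_cong_sets)
  then have [measurable]: "(\<lambda>w. \<Sum>q\<in>Q. w q * of_int (n q)) \<in> borel_measurable (PiM Q M)"
    by (intro borel_measurable_sum borel_measurable_times borel_measurable_const)
  show ?thesis
    unfolding torus_char_def[abs_def] cis_conv_exp by measurable
qed

lemma integral_torus_char:
  assumes "finite Q"
  shows "(\<integral>w. torus_char Q n w \<partial>PiM Q (\<lambda>_. unit_lebesgue)) = of_bool (\<forall>q\<in>Q. n q = 0)"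
proof -
  interpret product_sigma_finite "\<lambda>_::'a. unit_lebesgue"
    by standard
  have "(\<integral>w. torus_char Q n w \<partial>PiM Q (\<lambda>_. unit_lebesgue)) =
      (\<Prod>q\<in>Q. \<integral>x. cis (2 * pi * (x * of_int (n q))) \<partial>unit_lebesgue)"
    unfolding torus_char_eq_prod
  proof (rule product_integral_prod[OF assms])
    fix q
    show "integrable unit_lebesgue (\<lambda>x. cis (2 * pi * (x * of_int (n q))))"
      by (rule unit_lebesgue.integrable_const_bound[where B = 1])
         (auto simp: cis_conv_exp intro!: measurable_compose[OF _ borel_measurable_exp])
  qed
  also have "\<dots> = of_bool (\<forall>q\<in>Q. n q = 0)"
    using assms unfolding integral_cis_unit_lebesgue by (auto simp: prod_zero_iff)
  finally show ?thesis .
qed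

text \<open>Expanding the square, orthogonality keeps only pairs with equal frequencies. Distinct
  indices may share a frequency, so a double sum remains, with coefficients bounded by their
  moduli.\<close>

lemma nn_integral_torus_char_sum_le:
  fixes b :: "'r \<Rightarrow> complex"
  assumes "finite Q" "finite R"
  shows "(\<integral>\<^sup>+w. ennreal ((cmod (\<Sum>r\<in>R. b r * torus_char Q (n r) w))\<^sup>2) \<partial>PiM Q (\<lambda>_. unit_lebesgue)) \<le>
    ennreal (\<Sum>r\<in>R. \<Sum>s\<in>R. of_bool (\<forall>q\<in>Q. n r q = n s q) * (cmod (b r) * cmod (b s)))"
proof -
  let ?P = "PiM Q (\<lambda>_. unit_lebesgue)"
  let ?f = "\<lambda>w. \<Sum>r\<in>R. b r * torus_char Q (n r) w"
  interpret P: prob_space ?P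
    by (intro prob_space_PiM unit_lebesgue.prob_space_axioms)
  have meas [measurable]: "torus_char Q m \<in> borel_measurable ?P" for m
    by (intro borel_measurable_torus_char assms) simp
  have int: "integrable ?P (torus_char Q m)" for m
    by (rule P.integrable_const_bound[where B = 1]) auto
  have sq: "of_real ((cmod (?f w))\<^sup>2) = (\<Sum>r\<in>R. \<Sum>s\<in>R. b r * cnj (b s) * torus_char Q (\<lambda>q. n r q - n s q) w)" for w
    unfolding complex_norm_square cnj_sum sum_product
    by (intro sum.cong refl) (simp add: ac_simps flip: torus_char_diff)
  have "integrable ?P (\<lambda>w. of_real ((cmod (?f w))\<^sup>2) :: complex)"
    unfolding sq by (intro Bochner_Integration.integrable_sum integrable_mult_right int)
  then have intr: "integrable ?P (\<lambda>w. (cmod (?f w))\<^sup>2)"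
    by (simp only: complex_of_real_integrable_eq)
  have "complex_of_real (\<integral>w. (cmod (?f w))\<^sup>2 \<partial>?P) = (\<integral>w. of_real ((cmod (?f w))\<^sup>2) \<partial>?P)"
    by (rule integral_complex_of_real[symmetric])
  also have "\<dots> = (\<Sum>r\<in>R. \<Sum>s\<in>R. b r * cnj (b s) * of_bool (\<forall>q\<in>Q. n r q - n s q = 0))"
    unfolding sq using int integral_torus_char[OF assms(1)]
    by (simp add: Bochner_Integration.integral_sum)
  finally have eq: "complex_of_real (\<integral>w. (cmod (?f w))\<^sup>2 \<partial>?P) =
      (\<Sum>r\<in>R. \<Sum>s\<in>R. b r * cnj (b s) * of_bool (\<forall>q\<in>Q. n r q - n s q = 0))" .
  have "(\<integral>w. (cmod (?f w))\<^sup>2 \<partial>?P) \<le> cmod (complex_of_real (\<integral>w. (cmod (?f w))\<^sup>2 \<partial>?P))"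
    by simp
  also have "\<dots> \<le> (\<Sum>r\<in>R. \<Sum>s\<in>R. of_bool (\<forall>q\<in>Q. n r q = n s q) * (cmod (b r) * cmod (b s)))"
    unfolding eq
    by (intro order_trans[OF norm_sum] sum_mono) (auto simp: norm_mult)
  finally have "(\<integral>w. (cmod (?f w))\<^sup>2 \<partial>?P) \<le> \<dots>" .
  moreover have "(\<integral>\<^sup>+w. ennreal ((cmod (?f w))\<^sup>2) \<partial>?P) = ennreal (\<integral>w. (cmod (?f w))\<^sup>2 \<partial>?P)"
    by (intro nn_integral_eq_integral intr) auto
  ultimately show ?thesis
    by (simp add: ennreal_leI)
qed

text \<open>Fubini replaces one coordinate at a time, each at the cost of a factor \<open>K\<close>.
  This passes from phases with bounded density to uniform phases.\<close>

lemma nn_integral_PiM_mono_const: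
  fixes \<mu> \<nu> :: "'q \<Rightarrow> 'b measure" and K :: ennreal
  assumes "finite Q" and \<mu>: "\<And>q. sigma_finite_measure (\<mu> q)" and \<nu>: "\<And>q. sigma_finite_measure (\<nu> q)"
    and sets: "\<And>q. sets (\<mu> q) = sets (\<nu> q)"
    and dom: "\<And>q f. f \<in> borel_measurable (\<nu> q) \<Longrightarrow> integral\<^sup>N (\<mu> q) f \<le> K * integral\<^sup>N (\<nu> q) f"
    and f: "f \<in> borel_measurable (PiM Q \<nu>)"
  shows "integral\<^sup>N (PiM Q \<mu>) f \<le> K ^ card Q * integral\<^sup>N (PiM Q \<nu>) f"
proof -
  interpret \<mu>: product_sigma_finite \<mu>
    using \<mu> by (simp add: product_sigma_finite_def)
  interpret \<nu>: product_sigma_finite \<nu>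
    using \<nu> by (simp add: product_sigma_finite_def)
  show ?thesis
    using assms(1) f
  proof (induction Q arbitrary: f)
    case empty
    then show ?case
      by (simp add: \<mu>.nn_integral_empty \<nu>.nn_integral_empty)
  next
    case (insert i Q)
    note f = insert.prems
    have sets_PiM: "sets (PiM A \<mu>) = sets (PiM A \<nu>)" for A
      using sets by (intro sets_PiM_cong) auto
    have f\<mu>: "f \<in> borel_measurable (PiM (insert i Q) \<mu>)"
      using f sets_PiM by (simp cong: measurable_cong_sets)
    have joint: "(\<lambda>(x, y). f (x(i := y))) \<in> borel_measurable (PiM Q \<nu> \<Otimes>\<^sub>M \<nu> i)"
      using measurable_compose[OF measurable_add_dim f] by (simp add: case_prod_beta' fun_upd_def)
    have upd: "(\<lambda>y. f (x(i := y))) \<in> borel_measurable (\<nu> i)" if "x \<in> space (PiM Q \<nu>)" for x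
      using measurable_compose[OF measurable_Pair1'[OF that] joint] by simp
    have inner: "(\<lambda>x. \<integral>\<^sup>+y. f (x(i := y)) \<partial>\<nu> i) \<in> borel_measurable (PiM Q \<nu>)"
      using sigma_finite_measure.borel_measurable_nn_integral[OF \<nu> joint] by simp
    define h where "h x = (\<integral>\<^sup>+y. f (x(i := y)) \<partial>\<nu> i)" for x
    have h [measurable]: "h \<in> borel_measurable (PiM Q \<nu>)"
      using inner by (simp only: h_def[abs_def])
    have "integral\<^sup>N (PiM (insert i Q) \<mu>) f = (\<integral>\<^sup>+x. \<integral>\<^sup>+y. f (x(i := y)) \<partial>\<mu> i \<partial>PiM Q \<mu>)"
      by (rule \<mu>.product_nn_integral_insert) (use insert.hyps f\<mu> in auto)
    also have "\<dots> \<le> (\<integral>\<^sup>+x. K * h x \<partial>PiM Q \<mu>)"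
      unfolding h_def using upd sets_eq_imp_space_eq[OF sets_PiM[of Q]]
      by (intro nn_integral_mono dom) auto
    also have "\<dots> \<le> K ^ card Q * (\<integral>\<^sup>+x. K * h x \<partial>PiM Q \<nu>)"
      by (intro insert.IH) measurable
    also have "\<dots> = K ^ card (insert i Q) * (\<integral>\<^sup>+x. h x \<partial>PiM Q \<nu>)"
      using h insert.hyps by (simp add: nn_integral_cmult ac_simps)
    also have "(\<integral>\<^sup>+x. h x \<partial>PiM Q \<nu>) = integral\<^sup>N (PiM (insert i Q) \<nu>) f"
      unfolding h_def by (rule \<nu>.product_nn_integral_insert[symmetric]) (use insert.hyps f in auto)
    finally show ?case .
  qed
qed

section \<open>Fourth moments of off-diagonal character sums\<close>

definition freq :: "('q \<Rightarrow> nat) \<Rightarrow> nat \<times> nat \<Rightarrow> 'q \<Rightarrow> int" where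
  "freq deg p q = int (Suc (fst p)) ^ deg q - int (Suc (snd p)) ^ deg q"

text \<open>Moving negative terms across turns matching frequencies into equal power sums of two
  lists of length four. Degrees 1 to 8 determine such lists up to order, since
  \<open>4 + 4 \<le> 8\<close>.\<close>

lemma freq_match_imp_mset_eq:
  assumes "{1..8} \<subseteq> deg ` Q"
    and match: "\<forall>q\<in>Q. freq deg p1 q + freq deg p2 q = freq deg p3 q + freq deg p4 q"
  shows "mset [fst p1, fst p2, snd p3, snd p4] = mset [snd p1, snd p2, fst p3, fst p4]"
proof -
  let ?f = "\<lambda>k. real (Suc k)"
  have "mset (map ?f [fst p1, fst p2, snd p3, snd p4]) = mset (map ?f [snd p1, snd p2, fst p3, fst p4])"
  proof (rule power_sums_eq_imp_mset_eq[where d = 8])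
    fix n :: nat assume "1 \<le> n" "n \<le> 8"
    then have "n \<in> deg ` Q"
      using assms(1) by auto
    then obtain q where q: "q \<in> Q" "n = deg q" by auto
    have "of_int (freq deg p1 q + freq deg p2 q) = (of_int (freq deg p3 q + freq deg p4 q) :: real)"
      using match q by simp
    then show "(\<Sum>x\<leftarrow>map ?f [fst p1, fst p2, snd p3, snd p4]. x ^ n) =
        (\<Sum>x\<leftarrow>map ?f [snd p1, snd p2, fst p3, fst p4]. x ^ n)"
      by (simp add: freq_def q(2) algebra_simps)
  qed simp_all
  then have "image_mset ?f (mset [fst p1, fst p2, snd p3, snd p4]) =
      image_mset ?f (mset [snd p1, snd p2, fst p3, fst p4])"
    by (simp only: mset_map)
  moreover have "inj ?f"
    by (auto simp: inj_def)
  ultimately show ?thesis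
    using multiset.inj_map[of ?f] by (metis injD)
qed

lemma sum_Times: "(\<Sum>r\<in>A \<times> B. f r) = (\<Sum>x\<in>A. \<Sum>y\<in>B. f (x, y))"
  by (simp add: sum.cartesian_product)

text \<open>The fourth power is the squared modulus of the squared sum, itself a character sum over
  pairs with added frequencies. Orthogonality leaves the matched quadruples.\<close>

lemma fourth_moment_unit_lebesgue:
  fixes a :: "nat \<times> nat \<Rightarrow> complex"
  assumes "finite Q" "finite P" "{1..8} \<subseteq> deg ` Q" "\<And>p. p \<in> P \<Longrightarrow> fst p \<noteq> snd p"
  shows "(\<integral>\<^sup>+w. ennreal ((cmod (\<Sum>p\<in>P. a p * torus_char Q (freq deg p) w)) ^ 4) \<partial>PiM Q (\<lambda>_. unit_lebesgue))
    \<le> ennreal (768 * (\<Sum>p\<in>P. (cmod (a p))\<^sup>2)\<^sup>2)"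
proof -
  let ?n = "\<lambda>r q. freq deg (fst r) q + freq deg (snd r) q"
  let ?b = "\<lambda>r. a (fst r) * a (snd r)"
  let ?S = "\<lambda>w. \<Sum>p\<in>P. a p * torus_char Q (freq deg p) w"
  have sq: "(?S w)\<^sup>2 = (\<Sum>r\<in>P \<times> P. ?b r * torus_char Q (?n r) w)" for w
    unfolding power2_eq_square sum_product sum_Times
    by (intro sum.cong refl) (simp add: ac_simps flip: torus_char_add)
  have "(cmod (?S w)) ^ 4 = (cmod ((?S w)\<^sup>2))\<^sup>2" for w
    by (simp add: norm_power flip: power_mult)
  then have "(\<integral>\<^sup>+w. ennreal ((cmod (?S w)) ^ 4) \<partial>PiM Q (\<lambda>_. unit_lebesgue)) =
      (\<integral>\<^sup>+w. ennreal ((cmod (\<Sum>r\<in>P \<times> P. ?b r * torus_char Q (?n r) w))\<^sup>2) \<partial>PiM Q (\<lambda>_. unit_lebesgue))"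
    by (simp only: sq)
  also have "\<dots> \<le> ennreal (\<Sum>r\<in>P \<times> P. \<Sum>s\<in>P \<times> P.
      of_bool (\<forall>q\<in>Q. ?n r q = ?n s q) * (cmod (?b r) * cmod (?b s)))"
    using assms by (intro nn_integral_torus_char_sum_le) auto
  also have "(\<Sum>r\<in>P \<times> P. \<Sum>s\<in>P \<times> P. of_bool (\<forall>q\<in>Q. ?n r q = ?n s q) * (cmod (?b r) * cmod (?b s))) =
      (\<Sum>p1\<in>P. \<Sum>p2\<in>P. \<Sum>p3\<in>P. \<Sum>p4\<in>P.
        of_bool (\<forall>q\<in>Q. freq deg p1 q + freq deg p2 q = freq deg p3 q + freq deg p4 q) *
        (cmod (a p1) * cmod (a p2) * cmod (a p3) * cmod (a p4)))"
    by (simp add: sum_Times norm_mult ac_simps)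
  also have "\<dots> \<le> 768 * (\<Sum>p\<in>P. (cmod (a p))\<^sup>2)\<^sup>2"
    using assms by (intro sum_matched_le freq_match_imp_mset_eq[OF assms(3)]) auto
  finally show ?thesis
    by (simp add: ennreal_leI)
qed

section \<open>Measurability of the resolvent and the off-diagonal part of the form\<close>

lemma borel_measurable_det:
  fixes A :: "'a \<Rightarrow> complex mat"
  assumes "\<And>v. A v \<in> carrier_mat n n"
    and "\<And>i j. i < n \<Longrightarrow> j < n \<Longrightarrow> (\<lambda>v. A v $$ (i, j)) \<in> borel_measurable M"
  shows "(\<lambda>v. det (A v)) \<in> borel_measurable M"
  unfolding det_def'[OF assms(1)]
  by (intro borel_measurable_sum borel_measurable_times borel_measurable_const borel_measurable_prod assms(2))
    (auto dest: permutes_in_image)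

lemma borel_measurable_adj_mat:
  fixes A :: "'a \<Rightarrow> complex mat"
  assumes A: "\<And>v. A v \<in> carrier_mat n n"
    and meas: "\<And>i j. i < n \<Longrightarrow> j < n \<Longrightarrow> (\<lambda>v. A v $$ (i, j)) \<in> borel_measurable M"
    and "k < n" "l < n"
  shows "(\<lambda>v. adj_mat (A v) $$ (k, l)) \<in> borel_measurable M"
proof -
  have dims: "dim_row (A v) = n" "dim_col (A v) = n" for v
    using A[of v] by auto
  have "(\<lambda>v. det (mat_delete (A v) l k)) \<in> borel_measurable M"
  proof (rule borel_measurable_det)
    show "mat_delete (A v) l k \<in> carrier_mat (n - 1) (n - 1)" for v
      using A by (rule mat_delete_carrier)
  next
    fix i j assume "i < n - 1" "j < n - 1"
    then show "(\<lambda>v. mat_delete (A v) l k $$ (i, j)) \<in> borel_measurable M"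
      unfolding mat_delete_def dims by (auto intro!: meas)
  qed
  then have "(\<lambda>v. (-1) ^ (l + k) * det (mat_delete (A v) l k)) \<in> borel_measurable M"
    by (intro borel_measurable_times borel_measurable_const)
  then show ?thesis
    using assms(3,4) by (simp add: adj_mat_def cofactor_def dims)
qed

lemma borel_measurable_green:
  assumes x: "\<And>j k. j \<in> J \<Longrightarrow> k < N \<Longrightarrow> (\<lambda>v. x v j k) \<in> borel_measurable M"
    and "k < N" "l < N"
  shows "(\<lambda>v. green N J (x v) z l k) \<in> borel_measurable M"
proof -
  have cnj_meas: "(\<lambda>v. cnj (x v j k)) \<in> borel_measurable M" if "j \<in> J" "k < N" for j k
    using x[OF that] by (rule measurable_compose[OF _ borel_measurable_continuous_onI]) (intro continuous_intros)
  have entry: "(\<lambda>v. green_mat N J (x v) z $$ (i, j)) \<in> borel_measurable M" if "i < N" "j < N" for i j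
    using that x cnj_meas by (simp add: green_mat_def borel_measurable_sum borel_measurable_times)
  show ?thesis
    unfolding green_def using assms(2,3)
    by (intro borel_measurable_divide borel_measurable_det[where n = N]
        borel_measurable_adj_mat[where n = N] entry green_mat_carrier)
qed

lemma green_cong:
  assumes "\<And>j k. j \<in> J \<Longrightarrow> k < N \<Longrightarrow> x j k = x' j k"
  shows "green N J x z = green N J x' z"
proof -
  have "green_mat N J x z = green_mat N J x' z"
    unfolding green_mat_def using assms by (intro cong_mat) (auto intro!: sum.cong)
  then show ?thesis
    by (simp add: green_def[abs_def])
qed

text \<open>Since all entries of row \<open>i\<close> have the same modulus, the diagonal terms add
  up to exactly the normalized trace, and only \<open>k \<noteq> l\<close> remains.\<close>

lemma green_form_minus_trace:
  assumes "\<And>k. k < N \<Longrightarrow> (cmod (x i k))\<^sup>2 = 1 / real N"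
  shows "green_form N J x z i - green_trace N J x z / of_nat N =
    (\<Sum>p\<in>{p \<in> {..<N} \<times> {..<N}. fst p \<noteq> snd p}. green N J x z (snd p) (fst p) * (x i (fst p) * cnj (x i (snd p))))"
proof -
  let ?F = "\<lambda>k l. green N J x z l k * (x i k * cnj (x i l))"
  have diag: "?F k k = green N J x z k k / of_nat N" if "k < N" for k
    using assms[OF that] by (simp add: complex_norm_square[symmetric] del: of_real_power)
  have "green_form N J x z i = (\<Sum>k<N. \<Sum>l<N. ?F k l)"
    by (simp add: green_form_def app_def green_app_def sum_distrib_left ac_simps)
  also have "\<dots> = (\<Sum>p\<in>{..<N} \<times> {..<N}. ?F (fst p) (snd p))"
    by (simp add: sum_Times)
  also have "\<dots> = (\<Sum>p\<in>{p \<in> {..<N} \<times> {..<N}. fst p \<noteq> snd p}. ?F (fst p) (snd p)) +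
      (\<Sum>p\<in>{p \<in> {..<N} \<times> {..<N}. fst p = snd p}. ?F (fst p) (snd p))"
    by (subst sum.union_disjoint[symmetric]) (auto intro!: sum.cong)
  also have "(\<Sum>p\<in>{p \<in> {..<N} \<times> {..<N}. fst p = snd p}. ?F (fst p) (snd p)) = (\<Sum>k<N. ?F k k)"
    by (rule sum.reindex_bij_witness[where i = "\<lambda>k. (k, k)" and j = fst]) auto
  also have "\<dots> = green_trace N J x z / of_nat N"
    using diag by (simp add: green_trace_def sum_divide_distrib)
  finally show ?thesis
    by simp
qed

section \<open>Phase matrices\<close>

definition phase_row :: "nat \<Rightarrow> nat \<Rightarrow> (nat \<Rightarrow> nat \<Rightarrow> real) \<Rightarrow> nat \<Rightarrow> nat \<Rightarrow> complex" where
  "phase_row d N w j k =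
     of_real (1 / sqrt (real N)) * cis (2 * pi * (\<Sum>q = 1..d. w (Suc j) q * real (Suc k) ^ q))"

lemma phase_matrix_entry:
  "j < N \<Longrightarrow> k < N \<Longrightarrow> phase_matrix d N w $$ (j, k) = phase_row d N w j k"
  by (simp add: phase_matrix_def phase_row_def cis_conv_exp ac_simps)

lemma phase_row_cong:
  "(\<And>q. q \<in> {1..d} \<Longrightarrow> w (Suc j) q = w' (Suc j) q) \<Longrightarrow> phase_row d N w j k = phase_row d N w' j k"
  by (simp add: phase_row_def)

lemma cmod_phase_row: "(cmod (phase_row d N w j k))\<^sup>2 = 1 / real N"
  by (simp add: phase_row_def norm_mult norm_divide power_divide)

lemma covariance_matrix_mult_vec:
  assumes "u \<in> carrier_vec N" "j < N"
  shows "(covariance_matrix d N w *\<^sub>v u) $ j =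
    app N (phase_row d N w) (\<lambda>k. \<Sum>l<N. cnj (phase_row d N w l k) * u $ l) j"
proof -
  let ?X = "phase_matrix d N w"
  have X: "?X \<in> carrier_mat N N"
    by (simp add: phase_matrix_def)
  then have Xa: "mat_adjoint ?X \<in> carrier_mat N N"
    by (auto simp: mat_adjoint_def)
  have adj: "mat_adjoint ?X $$ (k, l) = cnj (phase_row d N w l k)" if "k < N" "l < N" for k l
    using that X by (simp add: mat_adjoint_def mat_of_rows_index phase_matrix_entry)
  have inner: "(mat_adjoint ?X *\<^sub>v u) $ k = (\<Sum>l<N. cnj (phase_row d N w l k) * u $ l)" if "k < N" for k
    using that Xa assms(1) adj by (auto simp: scalar_prod_def lessThan_atLeast0 intro!: sum.cong)
  have "(covariance_matrix d N w *\<^sub>v u) $ j = (?X *\<^sub>v (mat_adjoint ?X *\<^sub>v u)) $ j"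
    unfolding covariance_matrix_def using X Xa assms(1) by (subst assoc_mult_mat_vec) auto
  also have "\<dots> = (\<Sum>k<N. ?X $$ (j, k) * (mat_adjoint ?X *\<^sub>v u) $ k)"
    using X Xa assms by (auto simp: scalar_prod_def lessThan_atLeast0 intro!: sum.cong)
  also have "\<dots> = app N (phase_row d N w) (\<lambda>k. \<Sum>l<N. cnj (phase_row d N w l k) * u $ l) j"
    unfolding app_def using assms(2) by (intro sum.cong) (auto simp: inner phase_matrix_entry)
  finally show ?thesis .
qed

text \<open>For uniform phases the subtracted trace is the conditional mean given the rows other than \<open>i\<close>.\<close>

definition form_error :: "nat \<Rightarrow> nat \<Rightarrow> complex \<Rightarrow> nat \<Rightarrow> (nat \<Rightarrow> nat \<Rightarrow> real) \<Rightarrow> complex" where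
  "form_error d N z i w =
     green_form N ({..<N} - {i}) (phase_row d N w) z i -
     green_trace N ({..<N} - {i}) (phase_row d N w) z / of_nat N"

text \<open>The coordinates \<open>{Suc i} \<times> {1..d}\<close> form a block of the index set of
  all phases, so row \<open>i\<close> can be integrated separately from the others.\<close>

lemma phase_row_product:
  "phase_row d N w i k * cnj (phase_row d N w i l) =
    torus_char ({Suc i} \<times> {1..d}) (freq snd (k, l)) (\<lambda>(j, q). w j q) / of_nat N"
proof -
  have sq: "complex_of_real (1 / sqrt (real N)) * cnj (complex_of_real (1 / sqrt (real N))) = 1 / of_nat N"
  proof -
    have r: "complex_of_real r * cnj (complex_of_real r) = complex_of_real (r * r)" for r
      by simp
    have "1 / sqrt (real N) * (1 / sqrt (real N)) = 1 / real N"
      by simp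
    then show ?thesis
      unfolding r by simp
  qed
  have "cis (2 * pi * (\<Sum>q = 1..d. w (Suc i) q * real (Suc k) ^ q)) *
      cnj (cis (2 * pi * (\<Sum>q = 1..d. w (Suc i) q * real (Suc l) ^ q))) =
      torus_char ({Suc i} \<times> {1..d}) (freq snd (k, l)) (\<lambda>(j, q). w j q)"
    by (simp add: torus_char_def sum_Times freq_def cis_cnj cis_mult right_diff_distrib sum_subtractf)
  then show ?thesis
    unfolding phase_row_def using sq by (simp add: ac_simps)
qed

lemma form_error_eq:
  "form_error d N z i w =
    (\<Sum>p\<in>{p \<in> {..<N} \<times> {..<N}. fst p \<noteq> snd p}.
      (green N ({..<N} - {i}) (phase_row d N w) z (snd p) (fst p) / of_nat N) *
      torus_char ({Suc i} \<times> {1..d}) (freq snd p) (\<lambda>(j, q). w j q))"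
  unfolding form_error_def
  by (subst green_form_minus_trace) (auto simp: cmod_phase_row phase_row_product intro!: sum.cong)

text \<open>Allows the phases to be replaced by their restriction to
  \<open>{1..N} \<times> {1..d}\<close>, the index set of the product measure.\<close>

lemma form_error_cong:
  assumes "i < N" and "\<And>j q. j \<in> {1..N} \<Longrightarrow> q \<in> {1..d} \<Longrightarrow> w j q = w' j q"
  shows "form_error d N z i w = form_error d N z i w'"
proof -
  have row: "phase_row d N w j k = phase_row d N w' j k" if "j < N" for j k
    using assms(2) that by (intro phase_row_cong) auto
  have "green N ({..<N} - {i}) (phase_row d N w) z = green N ({..<N} - {i}) (phase_row d N w') z"
    using row by (intro green_cong) auto
  moreover have "torus_char ({Suc i} \<times> {1..d}) n (\<lambda>(j, q). w j q) =
      torus_char ({Suc i} \<times> {1..d}) n (\<lambda>(j, q). w' j q)" for n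
    using assms unfolding torus_char_def
    by (intro arg_cong[where f = cis] arg_cong2[where f = "(*)"] refl sum.cong) auto
  ultimately show ?thesis
    by (simp add: form_error_eq)
qed

text \<open>There are \<open>N\<close> columns, each of squared norm at most
  \<open>1 / (Im z)^2\<close>, against the normalization \<open>N^2\<close>.\<close>

lemma sum_green_sq_le:
  assumes "0 < Im z" "0 < N"
  shows "(\<Sum>p\<in>{p \<in> {..<N} \<times> {..<N}. fst p \<noteq> snd p}. (cmod (green N J x z (snd p) (fst p) / of_nat N))\<^sup>2)
    \<le> 1 / (real N * (Im z)\<^sup>2)"
proof -
  have "(\<Sum>p\<in>{p \<in> {..<N} \<times> {..<N}. fst p \<noteq> snd p}. (cmod (green N J x z (snd p) (fst p) / of_nat N))\<^sup>2)
      \<le> (\<Sum>p\<in>{..<N} \<times> {..<N}. (cmod (green N J x z (snd p) (fst p) / of_nat N))\<^sup>2)"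
    by (rule sum_mono2) auto
  also have "\<dots> = (\<Sum>k<N. \<Sum>l<N. (cmod (green N J x z l k) / real N)\<^sup>2)"
    by (simp add: sum_Times norm_divide)
  also have "\<dots> = (\<Sum>l<N. nsq N (green N J x z l)) / (real N)\<^sup>2"
    by (subst sum.swap) (simp add: nsq_def power_divide flip: sum_divide_distrib)
  also have "\<dots> \<le> (\<Sum>l<N. 1 / (Im z)\<^sup>2) / (real N)\<^sup>2"
    using assms by (intro divide_right_mono sum_mono nsq_green_le) auto
  also have "\<dots> = 1 / (real N * (Im z)\<^sup>2)"
    using assms by (simp add: power2_eq_square field_simps)
  finally show ?thesis .
qed

section \<open>Fourth moment and tail bound for the form error\<close>

lemma borel_measurable_form_error:
  assumes "i < N" and \<mu>: "sets \<mu> = sets borel"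
  shows "(\<lambda>v. form_error d N z i (\<lambda>j q. v (j, q))) \<in> borel_measurable (PiM ({1..N} \<times> {1..d}) (\<lambda>_. \<mu>))"
proof -
  let ?P = "PiM ({1..N} \<times> {1..d}) (\<lambda>_. \<mu>)"
  have comp: "(\<lambda>v. v (j, q)) \<in> borel_measurable ?P" if "j \<in> {1..N}" "q \<in> {1..d}" for j q
    using measurable_component_singleton[of "(j, q)" "{1..N} \<times> {1..d}" "\<lambda>_. \<mu>"] that \<mu>
    by (simp cong: measurable_cong_sets)
  have cis_meas: "(\<lambda>v. cis (f v)) \<in> borel_measurable ?P" if "f \<in> borel_measurable ?P" for f
    using that unfolding cis_conv_exp by measurable
  have row: "(\<lambda>v. phase_row d N (\<lambda>j q. v (j, q)) j k) \<in> borel_measurable ?P" if "j < N" for j k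
    unfolding phase_row_def
    using that
    by (intro borel_measurable_times borel_measurable_const cis_meas borel_measurable_sum comp) auto
  have char: "(\<lambda>v. torus_char ({Suc i} \<times> {1..d}) n (\<lambda>(j, q). v (j, q))) \<in> borel_measurable ?P" for n
    unfolding torus_char_def sum_Times case_prod_conv
    using assms(1)
    by (intro borel_measurable_times borel_measurable_const cis_meas borel_measurable_sum comp) auto
  show ?thesis
    unfolding form_error_eq using row
    by (intro borel_measurable_sum borel_measurable_times borel_measurable_divide borel_measurable_const
        borel_measurable_green char) auto
qed

lemma nn_integral_form_error_le:
  fixes \<rho> :: "real \<Rightarrow> real"
  defines "\<mu> \<equiv> density lborel (\<lambda>x. ennreal (\<rho> x * indicator {0..<1} x))"
  assumes \<rho>: "\<rho> \<in> borel_measurable borel" "\<And>x. x \<in> {0..1} \<Longrightarrow> \<rho> x \<le> R" "0 \<le> R"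
    and prob: "prob_space \<mu>" and "8 \<le> d" "i < N" "0 < Im z"
  shows "(\<integral>\<^sup>+v. ennreal (cmod (form_error d N z i (\<lambda>j q. v (j, q))) ^ 4) \<partial>PiM ({1..N} \<times> {1..d}) (\<lambda>_. \<mu>))
    \<le> ennreal (R ^ d * 768 / ((real N)\<^sup>2 * Im z ^ 4))"
proof -
  interpret \<mu>: prob_space \<mu> by fact
  interpret product_sigma_finite "\<lambda>_::nat \<times> nat. \<mu>" by standard
  have sets: "sets \<mu> = sets borel"
    by (simp add: \<mu>_def)
  define Q where "Q = {Suc i} \<times> {1..d}"
  define I where "I = ({1..N} - {Suc i}) \<times> {1..d}"
  define K where "K = ennreal (R ^ d * 768 / ((real N)\<^sup>2 * Im z ^ 4))"
  have IQ: "I \<inter> Q = {}" "finite I" "finite Q" "{1..N} \<times> {1..d} = I \<union> Q"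
    using assms by (auto simp: I_def Q_def)
  have "{1..8} \<subseteq> snd ` Q"
    using \<open>8 \<le> d\<close> by (force simp: Q_def)
  note Q = IQ(3) this
  let ?P = "{p \<in> {..<N} \<times> {..<N}. fst p \<noteq> snd p}"
  \<comment> \<open>The density is at most \<open>R\<close> on the unit interval, so
    \<open>\<mu>\<close> is dominated by \<open>R\<close> times Lebesgue measure; over the
    \<open>d\<close> phases of the row this costs \<open>R ^ d\<close>.\<close>
  have dom: "integral\<^sup>N \<mu> f \<le> ennreal R * integral\<^sup>N unit_lebesgue f" if "f \<in> borel_measurable unit_lebesgue" for f
  proof -
    have [measurable]: "f \<in> borel_measurable borel" "\<rho> \<in> borel_measurable borel"
      using that \<rho>(1) by (simp_all cong: measurable_cong_sets)
    have "integral\<^sup>N \<mu> f = (\<integral>\<^sup>+x. ennreal (\<rho> x * indicator {0..<1} x) * f x \<partial>lborel)"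
      unfolding \<mu>_def by (rule nn_integral_density) measurable
    also have "\<dots> \<le> (\<integral>\<^sup>+x. ennreal R * (ennreal (indicator {0..1} x) * f x) \<partial>lborel)"
      using \<rho>(2) by (intro nn_integral_mono) (auto simp: indicator_def intro!: mult_right_mono ennreal_leI)
    also have "\<dots> = ennreal R * (\<integral>\<^sup>+x. ennreal (indicator {0..1} x) * f x \<partial>lborel)"
      by (rule nn_integral_cmult) measurable
    also have "(\<integral>\<^sup>+x. ennreal (indicator {0..1} x) * f x \<partial>lborel) = integral\<^sup>N unit_lebesgue f"
      unfolding unit_lebesgue_def by (rule nn_integral_density[symmetric]) measurable
    finally show ?thesis .
  qed
  have inner: "(\<integral>\<^sup>+y. ennreal (cmod (form_error d N z i (\<lambda>j q. merge I Q (x, y) (j, q))) ^ 4) \<partial>PiM Q (\<lambda>_. \<mu>)) \<le> K" for x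
  proof -
    define a where "a p = green N ({..<N} - {i}) (phase_row d N (\<lambda>j q. x (j, q))) z (snd p) (fst p) / of_nat N"
      for p :: "nat \<times> nat"
    \<comment> \<open>With the other rows fixed at \<open>x\<close>, the error is a trigonometric
      polynomial in \<open>y\<close> whose coefficients \<open>a\<close> do not involve
      \<open>y\<close>.\<close>
    have err: "form_error d N z i (\<lambda>j q. merge I Q (x, y) (j, q)) = (\<Sum>p\<in>?P. a p * torus_char Q (freq snd p) y)" for y
    proof -
      have "green N ({..<N} - {i}) (phase_row d N (\<lambda>j q. merge I Q (x, y) (j, q))) z =
          green N ({..<N} - {i}) (phase_row d N (\<lambda>j q. x (j, q))) z"
        by (intro green_cong phase_row_cong) (auto simp: merge_def I_def)
      moreover have "torus_char Q n (\<lambda>(j, q). merge I Q (x, y) (j, q)) = torus_char Q n y" for n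
        unfolding torus_char_def
        by (intro arg_cong[where f = cis] arg_cong2[where f = "(*)"] refl sum.cong)
           (auto simp: merge_def I_def Q_def)
      ultimately show ?thesis
        unfolding form_error_eq a_def Q_def[symmetric] by simp
    qed
    have "(\<integral>\<^sup>+y. ennreal (cmod (form_error d N z i (\<lambda>j q. merge I Q (x, y) (j, q))) ^ 4) \<partial>PiM Q (\<lambda>_. \<mu>))
        \<le> ennreal R ^ card Q *
          (\<integral>\<^sup>+y. ennreal (cmod (\<Sum>p\<in>?P. a p * torus_char Q (freq snd p) y) ^ 4) \<partial>PiM Q (\<lambda>_. unit_lebesgue))"
      unfolding err
    proof (rule nn_integral_PiM_mono_const)
      have [measurable]: "torus_char Q n \<in> borel_measurable (PiM Q (\<lambda>_. unit_lebesgue))" for n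
        by (rule borel_measurable_torus_char[OF IQ(3)]) simp
      show "(\<lambda>y. ennreal (cmod (\<Sum>p\<in>?P. a p * torus_char Q (freq snd p) y) ^ 4)) \<in>
          borel_measurable (PiM Q (\<lambda>_. unit_lebesgue))"
        by measurable
    qed (use IQ sets dom \<mu>.sigma_finite_measure_axioms unit_lebesgue.sigma_finite_measure_axioms in auto)
    also have "\<dots> \<le> ennreal R ^ d * ennreal (768 * (\<Sum>p\<in>?P. (cmod (a p))\<^sup>2)\<^sup>2)"
      by (rule mult_mono) (auto simp: Q_def[symmetric] intro!: fourth_moment_unit_lebesgue Q, simp add: Q_def)
    also have "\<dots> \<le> ennreal R ^ d * ennreal (768 * (1 / (real N * (Im z)\<^sup>2))\<^sup>2)"
      unfolding a_def using assms
      by (intro mult_left_mono ennreal_leI power_mono sum_green_sq_le sum_nonneg) auto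
    also have "\<dots> = K"
    proof -
      have "R ^ d * (768 * (1 / (real N * (Im z)\<^sup>2))\<^sup>2) = R ^ d * 768 / ((real N)\<^sup>2 * Im z ^ 4)"
        by (simp add: power_divide power_mult_distrib flip: power_mult)
      then show ?thesis
        unfolding K_def ennreal_power[OF \<rho>(3)] using \<rho>(3) by (simp flip: ennreal_mult)
    qed
    finally show ?thesis .
  qed
  have "(\<integral>\<^sup>+v. ennreal (cmod (form_error d N z i (\<lambda>j q. v (j, q))) ^ 4) \<partial>PiM ({1..N} \<times> {1..d}) (\<lambda>_. \<mu>)) =
      (\<integral>\<^sup>+x. \<integral>\<^sup>+y. ennreal (cmod (form_error d N z i (\<lambda>j q. merge I Q (x, y) (j, q))) ^ 4) \<partial>PiM Q (\<lambda>_. \<mu>) \<partial>PiM I (\<lambda>_. \<mu>))"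
    unfolding IQ(4)
  proof (rule product_nn_integral_fold[OF IQ(1-3)])
    have [measurable]: "(\<lambda>v. form_error d N z i (\<lambda>j q. v (j, q))) \<in> borel_measurable (PiM (I \<union> Q) (\<lambda>_. \<mu>))"
      using borel_measurable_form_error[OF \<open>i < N\<close> sets, of d z] unfolding IQ(4) .
    show "(\<lambda>v. ennreal (cmod (form_error d N z i (\<lambda>j q. v (j, q))) ^ 4)) \<in> borel_measurable (PiM (I \<union> Q) (\<lambda>_. \<mu>))"
      by measurable
  qed
  also have "\<dots> \<le> (\<integral>\<^sup>+x. K \<partial>PiM I (\<lambda>_. \<mu>))"
    by (intro nn_integral_mono inner)
  also have "\<dots> = K"
  proof -
    have "prob_space (PiM I (\<lambda>_. \<mu>))"
      using prob by (intro prob_space_PiM)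
    then show ?thesis
      by (simp add: prob_space.emeasure_space_1)
  qed
  finally show ?thesis
    unfolding K_def .
qed

text \<open>Markov's inequality for the fourth power, after transport to the joint law of the
  phases.\<close>

lemma form_error_concentration:
  assumes iid: "iid_phases M \<rho> d N \<omega>"
    and \<rho>: "\<rho> \<in> borel_measurable borel" "\<And>x. x \<in> {0..1} \<Longrightarrow> \<rho> x \<le> R" "0 \<le> R"
    and "8 \<le> d" "i < N" "0 < Im z" "0 < \<epsilon>"
  shows "{x \<in> space M. \<epsilon> < cmod (form_error d N z i (\<lambda>j q. \<omega> j q x))} \<in> sets M" (is "?B \<in> _")
    and "emeasure M {x \<in> space M. \<epsilon> < cmod (form_error d N z i (\<lambda>j q. \<omega> j q x))} \<le>
      ennreal (R ^ d * 768 / ((real N)\<^sup>2 * Im z ^ 4) / \<epsilon> ^ 4)"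
proof -
  define \<mu> where "\<mu> = density lborel (\<lambda>x. ennreal (\<rho> x * indicator {0..<1} x))"
  let ?I = "{1..N} \<times> {1..d}"
  let ?P = "PiM ?I (\<lambda>_. borel :: real measure)"
  let ?X = "\<lambda>x. \<lambda>p\<in>?I. (\<lambda>(j, q). \<omega> j q) p x"
  interpret prob_space M
    using iid by (simp add: iid_phases_def)
  have rv: "random_variable borel ((\<lambda>(j, q). \<omega> j q) p)" and
    dist: "distr M borel ((\<lambda>(j, q). \<omega> j q) p) = \<mu>" if "p \<in> ?I" for p
  proof -
    from that obtain j q where p: "p = (j, q)" "j \<in> {1..N}" "q \<in> {1..d}"
      by (rule SigmaE)
    have D: "distributed M lborel (\<omega> j q) (\<lambda>x. ennreal (\<rho> x * indicator {0..<1} x))"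
      using iid p by (simp add: iid_phases_def)
    show "random_variable borel ((\<lambda>(j, q). \<omega> j q) p)"
      using distributed_measurable[OF D] p(1) by simp
    have "distr M borel (\<omega> j q) = distr M lborel (\<omega> j q)"
      by (rule distr_cong) auto
    then show "distr M borel ((\<lambda>(j, q). \<omega> j q) p) = \<mu>"
      using distributed_distr_eq_density[OF D] p(1) by (simp add: \<mu>_def)
  qed
  have ne: "(1, 1) \<in> ?I"
    using assms by auto
  have prob: "prob_space \<mu>"
    using prob_space_distr[OF rv[OF ne]] dist[OF ne] by simp
  have X: "?X \<in> measurable M ?P"
    using rv by (intro measurable_restrict) auto
  \<comment> \<open>Independence and the common marginal law make the joint law of the phases a
    product measure.\<close>
  have "distr M ?P ?X = PiM ?I (\<lambda>p. distr M borel ((\<lambda>(j, q). \<omega> j q) p))"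
    using iid ne rv by (subst indep_vars_iff_distr_eq_PiM'[symmetric]) (auto simp: iid_phases_def)
  also have "\<dots> = PiM ?I (\<lambda>_. \<mu>)"
    using dist by (intro PiM_cong) auto
  finally have joint: "distr M ?P ?X = PiM ?I (\<lambda>_. \<mu>)" .
  define F where "F v = cmod (form_error d N z i (\<lambda>j q. v (j, q)))" for v :: "nat \<times> nat \<Rightarrow> real"
  have F [measurable]: "F \<in> borel_measurable ?P"
    using borel_measurable_form_error[OF \<open>i < N\<close>, of borel d z] unfolding F_def[abs_def] by measurable
  have FX: "cmod (form_error d N z i (\<lambda>j q. \<omega> j q x)) = F (?X x)" for x
    unfolding F_def using \<open>i < N\<close> by (intro arg_cong[where f = cmod] form_error_cong) auto
  have FX_meas [measurable]: "(\<lambda>x. F (?X x)) \<in> borel_measurable M"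
    by (rule measurable_compose[OF X F])
  show B: "?B \<in> sets M"
    unfolding FX by measurable
  have "emeasure M ?B = (\<integral>\<^sup>+x. indicator ?B x \<partial>M)"
    using B by simp
  also have "\<dots> \<le> (\<integral>\<^sup>+x. ennreal (1 / \<epsilon> ^ 4) * ennreal (F (?X x) ^ 4) \<partial>M)"
  proof (rule nn_integral_mono)
    fix x
    have "1 \<le> 1 / \<epsilon> ^ 4 * F (?X x) ^ 4" if "x \<in> ?B"
    proof -
      have "\<epsilon> ^ 4 \<le> F (?X x) ^ 4"
        using that \<open>0 < \<epsilon>\<close> unfolding FX by (intro power_mono) auto
      then show ?thesis
        using \<open>0 < \<epsilon>\<close> by (simp add: field_simps)
    qed
    then show "indicator ?B x \<le> ennreal (1 / \<epsilon> ^ 4) * ennreal (F (?X x) ^ 4)"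
      using \<open>0 < \<epsilon>\<close> by (cases "x \<in> ?B") (auto simp flip: ennreal_mult ennreal_1 intro!: ennreal_leI)
  qed
  also have "\<dots> = ennreal (1 / \<epsilon> ^ 4) * (\<integral>\<^sup>+x. ennreal (F (?X x) ^ 4) \<partial>M)"
    by (rule nn_integral_cmult) measurable
  also have "(\<integral>\<^sup>+x. ennreal (F (?X x) ^ 4) \<partial>M) = (\<integral>\<^sup>+v. ennreal (F v ^ 4) \<partial>distr M ?P ?X)"
    by (rule nn_integral_distr[symmetric, OF X]) measurable
  also have "\<dots> = (\<integral>\<^sup>+v. ennreal (F v ^ 4) \<partial>PiM ?I (\<lambda>_. \<mu>))"
    by (simp only: joint)
  also have "\<dots> \<le> ennreal (R ^ d * 768 / ((real N)\<^sup>2 * Im z ^ 4))"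
    unfolding F_def \<mu>_def using assms prob by (intro nn_integral_form_error_le) (auto simp: \<mu>_def)
  also have "ennreal (1 / \<epsilon> ^ 4) * ennreal (R ^ d * 768 / ((real N)\<^sup>2 * Im z ^ 4)) =
      ennreal (R ^ d * 768 / ((real N)\<^sup>2 * Im z ^ 4) / \<epsilon> ^ 4)"
    using \<rho>(3) \<open>0 < \<epsilon>\<close> by (simp flip: ennreal_mult)
  finally show "emeasure M ?B \<le> ennreal (R ^ d * 768 / ((real N)\<^sup>2 * Im z ^ 4) / \<epsilon> ^ 4)"
    by (simp add: mult_left_mono)
qed

section \<open>From tail bounds to the probability of a large eigenvector entry\<close>

lemma torus_density_bounded:
  assumes "torus_density \<rho> C"
  obtains R where "\<rho> \<in> borel_measurable borel" "\<And>x. x \<in> {0..1} \<Longrightarrow> \<rho> x \<le> R" "0 \<le> R"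
proof -
  have cont: "continuous_on UNIV \<rho>"
    using assms by (auto simp: torus_density_def intro!: continuous_at_imp_continuous_on differentiable_imp_continuous_within)
  have "compact (\<rho> ` {0..1})"
    using cont by (intro compact_continuous_image) (auto intro: continuous_on_subset)
  then have "bdd_above (\<rho> ` {0..1})"
    by (intro bounded_imp_bdd_above compact_imp_bounded)
  then obtain R where "\<forall>y\<in>\<rho> ` {0..1}. y \<le> R"
    unfolding bdd_above_def by blast
  then have R: "\<rho> x \<le> R" if "x \<in> {0..1}" for x
    using that by blast
  have "0 \<le> R"
    using R[of 0] assms by (auto simp: torus_density_def intro: order_trans)
  with R that show thesis
    using borel_measurable_continuous_onI[OF cont] by blast
qed

text \<open>With \<open>p = moment_order d\<close> the value is
  \<open>(p - 18) / (36 (p + 2))\<close>, below \<open>1/36\<close> for every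
  \<open>p\<close>.\<close>

lemma theta0_less: "theta0 d < 1 / 36"
  by (simp add: theta0_def field_simps)

text \<open>Contrapositive of delocalization, restricted to grid energies so that finitely many
  spectral parameters serve every eigenvalue in the window.\<close>

lemma large_entry_imp_form_error:
  assumes N: "0 < N" and \<eta>: "0 < \<eta>" "\<eta> \<le> 1 / 2" "1 / (real N * \<eta>\<^sup>2) \<le> \<eta> / 4096"
    and E: "0 < \<kappa>" "\<kappa> < E" "E < 4"
    and ev: "eigenvector (covariance_matrix d N w) v (complex_of_real E)"
    and norm: "(\<Sum>i<N. (cmod (v $ i))\<^sup>2) = 1"
    and large: "Max ((\<lambda>i. (cmod (v $ i))\<^sup>2) ` {..<N}) > 20 / \<kappa> * \<eta>"
  shows "\<exists>g \<le> nat \<lfloor>4 / \<eta>\<rfloor>. \<exists>i < N. \<eta> / 4096 < cmod (form_error d N (Complex (real g * \<eta>) \<eta>) i w)"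
proof (rule ccontr)
  assume contr: "\<not> ?thesis"
  let ?x = "phase_row d N w"
  \<comment> \<open>The grid point just below \<open>E\<close>, at distance at most
    \<open>\<eta>\<close>; \<open>E < 4\<close> bounds its index.\<close>
  define g where "g = nat \<lfloor>E / \<eta>\<rfloor>"
  have "real g = of_int \<lfloor>E / \<eta>\<rfloor>"
    using E \<eta> by (simp add: g_def)
  then have "real g \<le> E / \<eta>" "E / \<eta> < real g + 1"
    by linarith+
  then have F: "real g * \<eta> \<le> E" "E \<le> real g * \<eta> + \<eta>"
    using \<eta>(1) by (auto simp: field_simps)
  have "g \<le> nat \<lfloor>4 / \<eta>\<rfloor>"
    unfolding g_def using E \<eta> by (intro nat_mono floor_mono divide_right_mono) auto
  with contr have close: "cmod (form_error d N (Complex (real g * \<eta>) \<eta>) i w) \<le> \<eta> / 4096" if "i < N" for i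
    using that by (meson not_le)
  have dim: "dim_row (covariance_matrix d N w) = N"
    by (simp add: covariance_matrix_def phase_matrix_def)
  have v: "v \<in> carrier_vec N" "covariance_matrix d N w *\<^sub>v v = of_real E \<cdot>\<^sub>v v"
    using ev by (auto simp: eigenvector_def dim)
  have eig: "app N ?x (\<lambda>k. \<Sum>j<N. cnj (?x j k) * v $ j) j = of_real E * v $ j" if "j < N" for j
    using covariance_matrix_mult_vec[OF v(1) that, of d w] v that by simp
  have "(cmod (v $ i))\<^sup>2 \<le> 20 / \<kappa> * \<eta>" if "i < N" for i
  proof -
    have "\<kappa> * (cmod (v $ i))\<^sup>2 \<le> E * (cmod (v $ i))\<^sup>2"
      using E by (intro mult_right_mono) auto
    also have "\<dots> \<le> 20 * \<eta>"
      by (rule eigenvector_delocalized[where x = ?x and F = "real g * \<eta>" and u = "\<lambda>j. v $ j", OF N _ \<eta>])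
        (use E F \<eta>(1) close eig norm that in \<open>auto simp: cmod_phase_row form_error_def\<close>)
    finally show ?thesis
      using E by (simp add: field_simps)
  qed
  then have "Max ((\<lambda>i. (cmod (v $ i))\<^sup>2) ` {..<N}) \<le> 20 / \<kappa> * \<eta>"
    using N by (subst Max_le_iff) auto
  with large show False by simp
qed

text \<open>The eigenvectors are an arbitrary function of the sample point, so their event need not
  be measurable; it lies in a measurable union of form error events. The union bound multiplies
  \<open>N\<close> rows, at most \<open>5 / \<eta>\<close> energies and a tail of order
  \<open>1 / (N^2 \<eta>^8)\<close>.\<close>

lemma outer_measure_large_entry_le:
  assumes iid: "iid_phases M \<rho> d N \<omega>"
    and \<rho>: "\<rho> \<in> borel_measurable borel" "\<And>x. x \<in> {0..1} \<Longrightarrow> \<rho> x \<le> R" "0 \<le> R"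
    and d: "8 \<le> d" and N: "0 < N" and \<kappa>: "0 < \<kappa>"
    and \<eta>: "0 < \<eta>" "\<eta> \<le> 1 / 2" "1 / (real N * \<eta>\<^sup>2) \<le> \<eta> / 4096"
    and norm: "\<And>x. x \<in> space M \<Longrightarrow> (\<Sum>i<N. (cmod (v x $ i))\<^sup>2) = 1"
  shows "outer_measure_of M
       {x \<in> space M.
          (\<exists>E::real. \<kappa> < E \<and> E < 4 - \<kappa> \<and>
             eigenvector (covariance_matrix d N (\<lambda>j q. \<omega> j q x)) (v x) (complex_of_real E)) \<and>
          Max ((\<lambda>i. (cmod (v x $ i))\<^sup>2) ` {..<N}) > 20 / \<kappa> * \<eta>}
    \<le> ennreal (5 * 768 * 4096 ^ 4 * R ^ d * (1 / (real N * \<eta> ^ 9)))" (is "outer_measure_of M ?S \<le> _")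
proof -
  define B where "B g i = {x \<in> space M. \<eta> / 4096 < cmod (form_error d N (Complex (real g * \<eta>) \<eta>) i (\<lambda>j q. \<omega> j q x))}"
    for g i :: nat
  define G where "G = nat \<lfloor>4 / \<eta>\<rfloor>"
  define p where "p = R ^ d * 768 / ((real N)\<^sup>2 * \<eta> ^ 4) / (\<eta> / 4096) ^ 4"
  have B: "B g i \<in> sets M" "emeasure M (B g i) \<le> ennreal p" if "i < N" for g i
    using form_error_concentration[OF iid \<rho> d that, of "Complex (real g * \<eta>) \<eta>" "\<eta> / 4096"] \<eta>(1)
    by (auto simp: B_def p_def)
  have p0: "0 \<le> p"
    using \<rho>(3) \<eta>(1) by (simp add: p_def)
  let ?U = "\<Union>r\<in>{..G} \<times> {..<N}. B (fst r) (snd r)"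
  have "?S \<subseteq> ?U"
  proof
    fix x assume "x \<in> ?S"
    then obtain E where x: "x \<in> space M" "\<kappa> < E" "E < 4 - \<kappa>"
      "eigenvector (covariance_matrix d N (\<lambda>j q. \<omega> j q x)) (v x) (complex_of_real E)"
      "Max ((\<lambda>i. (cmod (v x $ i))\<^sup>2) ` {..<N}) > 20 / \<kappa> * \<eta>"
      by auto
    have "\<exists>g \<le> nat \<lfloor>4 / \<eta>\<rfloor>. \<exists>i < N. \<eta> / 4096 < cmod (form_error d N (Complex (real g * \<eta>) \<eta>) i (\<lambda>j q. \<omega> j q x))"
      using x \<kappa> by (intro large_entry_imp_form_error[OF N \<eta> \<kappa> x(2) _ x(4) norm[OF x(1)] x(5)]) auto
    then show "x \<in> ?U"
      using x(1) by (auto simp: B_def G_def)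
  qed
  then have "outer_measure_of M ?S \<le> outer_measure_of M ?U"
    by (rule outer_measure_of_mono)
  also have "\<dots> = emeasure M ?U"
    using B by (intro outer_measure_of_eq sets.finite_UN) auto
  also have "\<dots> \<le> (\<Sum>r\<in>{..G} \<times> {..<N}. emeasure M (B (fst r) (snd r)))"
    using B by (intro emeasure_subadditive_finite) auto
  also have "\<dots> \<le> (\<Sum>r\<in>{..G} \<times> {..<N}. ennreal p)"
    using B by (intro sum_mono) auto
  also have "\<dots> = ennreal (real (Suc G * N) * p)"
    using p0 by (simp only: sum_constant card_cartesian_product card_atMost card_lessThan
        ennreal_of_nat_eq_real_of_nat of_nat_0_le_iff flip: ennreal_mult)
  also have "\<dots> \<le> ennreal (5 * 768 * 4096 ^ 4 * R ^ d * (1 / (real N * \<eta> ^ 9)))"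
  proof (rule ennreal_leI)
    have "real G \<le> 4 / \<eta>"
      using \<eta>(1) by (simp add: G_def)
    moreover have "1 \<le> 1 / \<eta>"
      using \<eta> by (simp add: field_simps)
    ultimately have "real (Suc G) \<le> 5 / \<eta>"
      by simp
    then have "real (Suc G * N) * p \<le> (5 / \<eta> * real N) * p"
      unfolding of_nat_mult using p0 by (intro mult_right_mono) auto
    also have "\<dots> = 5 * 768 * 4096 ^ 4 * R ^ d * (1 / (real N * \<eta> ^ 9))"
    proof -
      have "\<eta> * \<eta> ^ 8 = \<eta> ^ 9"
        by (simp flip: power_Suc)
      then show ?thesis
        using N \<eta>(1) by (simp add: p_def field_simps power2_eq_square power_divide)
    qed
    finally show "real (Suc G * N) * p \<le> 5 * 768 * 4096 ^ 4 * R ^ d * (1 / (real N * \<eta> ^ 9))" .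
  qed
  finally show ?thesis .
qed

theorem theorem2p8:
  fixes \<rho> :: "real \<Rightarrow> real" and C\<^sub>\<rho> \<kappa> \<theta> :: real and d :: nat
    and M :: "nat \<Rightarrow> 'a measure" and \<omega> :: "nat \<Rightarrow> nat \<Rightarrow> nat \<Rightarrow> 'a \<Rightarrow> real"
  assumes "torus_density \<rho> C\<^sub>\<rho>"
    and "\<And>N. N \<ge> 1 \<Longrightarrow> iid_phases (M N) \<rho> d N (\<omega> N)"
    and "d \<ge> 18"
    and "0 < \<kappa>" and "\<kappa> < 1"
    and "0 < \<theta>" and "\<theta> < theta0 d"
  shows "\<exists>C>0. \<forall>(u :: nat \<Rightarrow> 'a \<Rightarrow> nat \<Rightarrow> complex vec) (\<alpha> :: nat \<Rightarrow> nat).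
    (\<forall>N\<ge>1. \<alpha> N \<in> {1..N} \<and>
       (\<forall>x\<in>space (M N).
          normalized_eigenbasis N (covariance_matrix d N (\<lambda>j q. \<omega> N j q x)) (u N x))) \<longrightarrow>
    (\<lambda>N. outer_measure_of (M N)
       {x \<in> space (M N).
          (\<exists>E::real. \<kappa> < E \<and> E < 4 - \<kappa> \<and>
             eigenvector (covariance_matrix d N (\<lambda>j q. \<omega> N j q x)) (u N x (\<alpha> N))
               (complex_of_real E)) \<and>
          Max ((\<lambda>i. (cmod (vec_index (u N x (\<alpha> N)) i))\<^sup>2) ` {..<N})
            > C * real N powr (- \<theta>)})
    \<longlonglongrightarrow> 0"
proof (intro exI[of _ "20 / \<kappa>"] conjI allI impI)
  \<comment> \<open>The witness is fixed before the eigenvectors are chosen: delocalization gives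
    \<open>E |u(i)|^2 \<le> 20 \<eta>\<close>, and \<open>E > \<kappa>\<close>.\<close>
  show "0 < 20 / \<kappa>"
    using assms by simp
next
  fix u :: "nat \<Rightarrow> 'a \<Rightarrow> nat \<Rightarrow> complex vec" and \<alpha> :: "nat \<Rightarrow> nat"
  assume u: "\<forall>N\<ge>1. \<alpha> N \<in> {1..N} \<and>
       (\<forall>x\<in>space (M N).
          normalized_eigenbasis N (covariance_matrix d N (\<lambda>j q. \<omega> N j q x)) (u N x))"
  let ?S = "\<lambda>N. {x \<in> space (M N).
          (\<exists>E::real. \<kappa> < E \<and> E < 4 - \<kappa> \<and>
             eigenvector (covariance_matrix d N (\<lambda>j q. \<omega> N j q x)) (u N x (\<alpha> N))
               (complex_of_real E)) \<and>
          Max ((\<lambda>i. (cmod (vec_index (u N x (\<alpha> N)) i))\<^sup>2) ` {..<N})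
            > 20 / \<kappa> * real N powr (- \<theta>)}"
  obtain R where R: "\<rho> \<in> borel_measurable borel" "\<And>x. x \<in> {0..1} \<Longrightarrow> \<rho> x \<le> R" "0 \<le> R"
    using torus_density_bounded[OF assms(1)] by blast
  have \<theta>: "0 < \<theta>" "\<theta> < 1 / 36"
    using assms(6,7) theta0_less[of d] by simp_all
  define K where "K = 5 * 768 * 4096 ^ 4 * R ^ d"
  have neg: "(\<lambda>N. real N powr (- s)) \<longlonglongrightarrow> 0" if "0 < s" for s :: real
    using that by (intro tendsto_neg_powr filterlim_real_sequentially) simp
  \<comment> \<open>With \<open>\<eta> = N powr (-\<theta>)\<close>, the two eventual bounds say
    \<open>\<eta> < 1/2\<close> and \<open>1 / (N \<eta>^3) < 1/4096\<close>, the smallness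
    conditions of the deterministic part.\<close>
  have "\<forall>\<^sub>F N in sequentially. real N powr (- \<theta>) < 1 / 2"
    using neg[OF \<theta>(1)] by (rule order_tendstoD) simp
  moreover have "\<forall>\<^sub>F N in sequentially. real N powr (- (1 - 3 * \<theta>)) < 1 / 4096"
    using neg[of "1 - 3 * \<theta>"] \<theta> by (intro order_tendstoD) auto
  ultimately have bound: "\<forall>\<^sub>F N in sequentially. outer_measure_of (M N) (?S N) \<le> ennreal (K * real N powr (- (1 - 9 * \<theta>)))"
    using eventually_ge_at_top[of 1]
  proof eventually_elim
    case (elim N)
    define \<eta> where "\<eta> = real N powr (- \<theta>)"
    have N: "0 < N" "1 \<le> N" and \<eta>: "0 < \<eta>"
      using elim by (auto simp: \<eta>_def)
    have inv: "1 / (real N * \<eta> ^ k) = real N powr (- (1 - real k * \<theta>))" for k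
      using N by (simp add: \<eta>_def powr_power powr_diff powr_minus field_simps flip: powr_add)
    have "1 / (real N * \<eta>\<^sup>2) = 1 / (real N * \<eta> ^ 3) * \<eta>"
      using \<eta> by (simp add: power2_eq_square power3_eq_cube)
    also have "\<dots> \<le> 1 / 4096 * \<eta>"
      using elim(2) \<eta> inv[of 3] by (intro mult_right_mono) auto
    finally have small: "1 / (real N * \<eta>\<^sup>2) \<le> \<eta> / 4096"
      by simp
    have "outer_measure_of (M N) (?S N) \<le> ennreal (5 * 768 * 4096 ^ 4 * R ^ d * (1 / (real N * \<eta> ^ 9)))"
      unfolding \<eta>_def[symmetric]
    proof (rule outer_measure_large_entry_le[OF assms(2)[OF N(2)] R _ N(1) assms(4) \<eta> _ small])
      fix x assume "x \<in> space (M N)"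
      with u N(2) show "(\<Sum>i<N. (cmod (u N x (\<alpha> N) $ i))\<^sup>2) = 1"
        by (simp add: normalized_eigenbasis_def)
    qed (use assms elim(1) in \<open>auto simp: \<eta>_def\<close>)
    also have "\<dots> = ennreal (K * real N powr (- (1 - 9 * \<theta>)))"
      using inv[of 9] by (simp add: K_def)
    finally show ?case .
  qed
  \<comment> \<open>Since \<open>\<theta> < 1/36\<close>, the decay exponent
    \<open>1 - 9 \<theta>\<close> exceeds \<open>3/4\<close>.\<close>
  have "(\<lambda>N. K * real N powr (- (1 - 9 * \<theta>))) \<longlonglongrightarrow> K * 0"
    using neg[of "1 - 9 * \<theta>"] \<theta> by (intro tendsto_mult tendsto_const) auto
  then have "(\<lambda>N. ennreal (K * real N powr (- (1 - 9 * \<theta>)))) \<longlonglongrightarrow> ennreal 0"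
    by (intro tendsto_ennrealI) simp
  then have "(\<lambda>N. ennreal (K * real N powr (- (1 - 9 * \<theta>)))) \<longlonglongrightarrow> 0"
    by simp
  from tendsto_sandwich[OF _ bound tendsto_const this]
  show "(\<lambda>N. outer_measure_of (M N) (?S N)) \<longlonglongrightarrow> 0"
    by simp
qed

end
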